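(* Let $m>1$ and $n>1$ be integers. Then the group $G_{mn}=\langle a,b;\ [a^m,b^n]=1\rangle$ is conjugacy separable.
   Context: $[x,y]=x^{-1}y^{-1}xy$. A group $G$ is conjugacy separable if for any two elements $f,g\in G$ that are not conjugate in $G$ there exists a homomorphism $\varphi$ of $G$ onto some finite group $X$ such that $f\varphi$ and $g\varphi$ are not conjugate in $X$. *)

theory Defs
  imports "HOL-Algebra.Group"
begin

text \<open>Words over the two generators a, b and their inverses.
  A letter is a pair (g, e): g = False means a, g = True means b;
  e = True means the generator itself, e = False its inverse.\<close>

type_synonym letter = "bool \<times> bool"

definition flip :: "letter \<Rightarrow> letter" where
  "flip x = (fst x, \<not> snd x)"

inductive word_eqv :: "letter list \<Rightarrow> letter list \<Rightarrow> letter list \<Rightarrow> bool" for r where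
  refl: "word_eqv r w w"
| sym: "word_eqv r u v \<Longrightarrow> word_eqv r v u"
| trans: "word_eqv r u v \<Longrightarrow> word_eqv r v w \<Longrightarrow> word_eqv r u w"
| cancel: "word_eqv r (u @ [x, flip x] @ v) (u @ v)"
| relator: "word_eqv r (u @ r @ v) (u @ v)"

definition pres_group :: "letter list \<Rightarrow> letter list set monoid" where
  "pres_group r = \<lparr> carrier = {{v. word_eqv r w v} | w. True},
      monoid.mult = (\<lambda>A B. {w. \<exists>u\<in>A. \<exists>v\<in>B. word_eqv r (u @ v) w}),
      one = {v. word_eqv r [] v} \<rparr>"

abbreviation gen_a :: letter where "gen_a \<equiv> (False, True)"
abbreviation gen_b :: letter where "gen_b \<equiv> (True, True)"

definition comm_relator :: "nat \<Rightarrow> nat \<Rightarrow> letter list" where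
  "comm_relator m n =
     replicate m (flip gen_a) @ replicate n (flip gen_b) @ replicate m gen_a @ replicate n gen_b"

definition G_mn :: "nat \<Rightarrow> nat \<Rightarrow> letter list set monoid" where
  "G_mn m n = pres_group (comm_relator m n)"

definition conjugate_in :: "('a, 'b) monoid_scheme \<Rightarrow> 'a \<Rightarrow> 'a \<Rightarrow> bool" where
  "conjugate_in G f g \<longleftrightarrow> (\<exists>h\<in>carrier G. g = inv\<^bsub>G\<^esub> h \<otimes>\<^bsub>G\<^esub> f \<otimes>\<^bsub>G\<^esub> h)"

text \<open>Conjugacy separability. Every finite group is isomorphic to one with
  carrier a finite set of naturals, so finite quotients are taken of type nat monoid.\<close>
definition conjugacy_separable :: "('a, 'b) monoid_scheme \<Rightarrow> bool" where
  "conjugacy_separable G \<longleftrightarrow>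
     (\<forall>f\<in>carrier G. \<forall>g\<in>carrier G. \<not> conjugate_in G f g \<longrightarrow>
        (\<exists>(X :: nat monoid) \<phi>. group X \<and> finite (carrier X) \<and> \<phi> \<in> hom G X \<and>
           \<phi> ` carrier G = carrier X \<and> \<not> conjugate_in X (\<phi> f) (\<phi> g)))"

end

theory Submission
  imports Defs "HOL-Algebra.Weak_Morphisms"
begin

text \<open>
  Every word is conjugate either to an elliptic word \<open>a\<^sup>p b\<^sup>q\<close> with \<open>p = 0\<close>, \<open>q = 0\<close> or both powers in the
  subgroup \<open>\<langle>a\<^sup>m, b\<^sup>n\<rangle>\<close>, or to a cyclically reduced product of syllables. Elliptic words are told apart
  by their exponent sums. For a cyclically reduced \<open>f\<close> of length \<open>k\<close> one builds a finite linear
  representation: generators translate a state \<open>(i, j)\<close> recording exponents of \<open>a\<close> and \<open>b\<close>, and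
  are conjugated by unipotent maps that let a position \<open>v\<close> hop to \<open>v + 1\<close> only through a gate modelled on
  the \<open>v\<close>-th syllable of \<open>f\<close>. The gates of \<open>a\<close> depend on \<open>i\<close> modulo \<open>m\<close> only, so the unipotent map commutes with
  \<open>a\<^sup>m\<close>; hence \<open>a\<^sup>m\<close> and likewise \<open>b\<^sup>n\<close> act by pure translations, and they commute. The contribution to
  the trace of closed paths winding once around the positions is a class function. It is positive on \<open>f\<close>,
  and on a word \<open>g\<close> with at most as many syllables it vanishes unless \<open>g\<close> matches a rotation of \<open>f\<close> so
  closely that the two are conjugate. No normal form theorem for amalgams is needed, because the
  representations themselves separate what the reduction leaves apart.
\<close>

subsection \<open>Congruences on words\<close>

text \<open>Such relations are the kernels of homomorphisms from the free group on \<open>a\<close>,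
  \<open>b\<close>, seen on words, so finite quotients can be built directly as relations on letter
  lists.\<close>

definition word_cong :: "(letter list \<Rightarrow> letter list \<Rightarrow> bool) \<Rightarrow> bool" where
  "word_cong R \<longleftrightarrow> equivp R \<and> (\<forall>u u' v v'. R u u' \<longrightarrow> R v v' \<longrightarrow> R (u @ v) (u' @ v'))
     \<and> (\<forall>x. R [x, flip x] [])"

definition word_class :: "(letter list \<Rightarrow> letter list \<Rightarrow> bool) \<Rightarrow> letter list \<Rightarrow> letter list set" where
  "word_class R w = {v. R w v}"

definition quotient_group :: "(letter list \<Rightarrow> letter list \<Rightarrow> bool) \<Rightarrow> letter list set monoid" where
  "quotient_group R = \<lparr> carrier = {{v. R w v} | w. True},
      monoid.mult = (\<lambda>A B. {w. \<exists>u\<in>A. \<exists>v\<in>B. R (u @ v) w}),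
      one = {v. R [] v} \<rparr>"

definition inv_word :: "letter list \<Rightarrow> letter list" where
  "inv_word w = rev (map flip w)"

lemma flip_flip [simp]: "flip (flip x) = x"
  by (simp add: flip_def)

lemma inv_word_inv_word [simp]: "inv_word (inv_word w) = w"
  by (simp add: inv_word_def rev_map o_def)

context
  fixes R assumes R: "word_cong R"
begin

lemma R_refl [simp]: "R u u"
  using R unfolding word_cong_def by (meson equivp_reflp)

lemma R_sym: "R u v \<Longrightarrow> R v u"
  using R unfolding word_cong_def by (meson equivp_symp)

lemma R_trans: "R u v \<Longrightarrow> R v w \<Longrightarrow> R u w"
  using R unfolding word_cong_def by (meson equivp_transp)

lemma R_append: "R u u' \<Longrightarrow> R v v' \<Longrightarrow> R (u @ v) (u' @ v')"
  using R unfolding word_cong_def by blast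

lemma R_cancel: "R [x, flip x] []"
  using R unfolding word_cong_def by blast

lemma R_inv_right: "R (w @ inv_word w) []"
proof (induction w)
  case (Cons x w)
  have "R ([x] @ (w @ inv_word w) @ [flip x]) ([x] @ [] @ [flip x])"
    by (rule R_append[OF R_refl R_append[OF Cons R_refl]])
  with R_cancel[of x] show ?case by (auto simp: inv_word_def intro: R_trans)
qed (simp add: inv_word_def)

lemma R_inv_left: "R (inv_word w @ w) []"
  using R_inv_right[of "inv_word w"] by simp

lemma word_class_eq_iff: "word_class R u = word_class R v \<longleftrightarrow> R u v"
  unfolding word_class_def using R_sym R_trans R_refl by blast

lemma carrier_quotient_group: "carrier (quotient_group R) = range (word_class R)"
  by (auto simp: quotient_group_def word_class_def)

lemma one_quotient_group: "\<one>\<^bsub>quotient_group R\<^esub> = word_class R []"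
  by (simp add: quotient_group_def word_class_def)

lemma mult_quotient_group: "word_class R u \<otimes>\<^bsub>quotient_group R\<^esub> word_class R v = word_class R (u @ v)"
proof -
  have "R (u @ v) w" if "R u u'" "R v v'" "R (u' @ v') w" for u' v' w
    using R_trans[OF R_append[OF that(1,2)] that(3)] .
  moreover have "\<exists>u'\<in>word_class R u. \<exists>v'\<in>word_class R v. R (u' @ v') w" if "R (u @ v) w" for w
    using that R_refl unfolding word_class_def by blast
  ultimately show ?thesis
    unfolding quotient_group_def by (auto simp: word_class_def)
qed

lemma group_quotient_group: "group (quotient_group R)"
proof (rule groupI)
  fix x assume "x \<in> carrier (quotient_group R)"
  then obtain u where "x = word_class R u" by (auto simp: carrier_quotient_group)
  then have "word_class R (inv_word u) \<otimes>\<^bsub>quotient_group R\<^esub> x = \<one>\<^bsub>quotient_group R\<^esub>"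
    by (simp add: mult_quotient_group one_quotient_group word_class_eq_iff R_inv_left)
  then show "\<exists>y\<in>carrier (quotient_group R). y \<otimes>\<^bsub>quotient_group R\<^esub> x = \<one>\<^bsub>quotient_group R\<^esub>"
    by (auto simp: carrier_quotient_group)
qed (auto simp: carrier_quotient_group mult_quotient_group one_quotient_group)

text \<open>Clearing the inverse from g = h^-1 f h leaves an equation between words, the form in
  which conjugacy is handled from here on.\<close>

lemma conjugate_in_quotient_group:
  "conjugate_in (quotient_group R) (word_class R f) (word_class R g) \<longleftrightarrow> (\<exists>h. R (f @ h) (h @ g))"
proof -
  interpret Q: group "quotient_group R" by (rule group_quotient_group)
  have mem: "word_class R w \<in> carrier (quotient_group R)" for w
    by (simp add: carrier_quotient_group)
  have "word_class R g = inv\<^bsub>quotient_group R\<^esub> (word_class R h) \<otimes>\<^bsub>quotient_group R\<^esub> word_class R f \<otimes>\<^bsub>quotient_group R\<^esub> word_class R h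
        \<longleftrightarrow> R (f @ h) (h @ g)" for h
  proof -
    have "word_class R g = inv\<^bsub>quotient_group R\<^esub> (word_class R h) \<otimes>\<^bsub>quotient_group R\<^esub> word_class R f \<otimes>\<^bsub>quotient_group R\<^esub> word_class R h
      \<longleftrightarrow> word_class R h \<otimes>\<^bsub>quotient_group R\<^esub> word_class R g = word_class R f \<otimes>\<^bsub>quotient_group R\<^esub> word_class R h"
      by (auto simp add: Q.m_assoc Q.inv_solve_left mem)
    then show ?thesis by (metis mult_quotient_group word_class_eq_iff)
  qed
  then show ?thesis
    unfolding conjugate_in_def by (auto simp: carrier_quotient_group)
qed

end

section \<open>Separation of words in finite quotients of a presentation\<close>

lemma word_eqv_context: "word_eqv r u v \<Longrightarrow> word_eqv r (p @ u @ s) (p @ v @ s)"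
proof (induction rule: word_eqv.induct)
  case (cancel u x v)
  then show ?case using word_eqv.cancel[of r "p @ u" x "v @ s"] by simp
next
  case (relator u v)
  then show ?case using word_eqv.relator[of r "p @ u" "v @ s"] by simp
qed (auto intro: word_eqv.intros)

lemma word_cong_word_eqv: "word_cong (word_eqv r)"
  unfolding word_cong_def
proof (intro conjI allI impI equivpI reflpI sympI transpI)
  fix u u' v v' assume "word_eqv r u u'" "word_eqv r v v'"
  then show "word_eqv r (u @ v) (u' @ v')"
    using word_eqv_context[of r u u' "[]" v] word_eqv_context[of r v v' u' "[]"]
    by (auto intro: word_eqv.trans)
next
  show "word_eqv r [x, flip x] []" for x
    using word_eqv.cancel[of r "[]" x "[]"] by simp
qed (auto intro: word_eqv.intros)

lemma pres_group_eq: "pres_group r = quotient_group (word_eqv r)"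
  by (simp add: pres_group_def quotient_group_def)

text \<open>The goal in congruence form: \<open>R\<close> stands for a finite quotient of the
  presented group that keeps the conjugacy classes of \<open>f\<close> and \<open>g\<close>
  apart.\<close>

definition separable_words :: "letter list \<Rightarrow> letter list \<Rightarrow> letter list \<Rightarrow> bool" where
  "separable_words r f g \<longleftrightarrow> (\<exists>R. word_cong R \<and> word_eqv r \<le> R \<and> finite (range (word_class R)) \<and>
      (\<forall>h. \<not> R (f @ h) (h @ g)))"

lemma separable_words_imp_finite_quotient:
  assumes "separable_words r f g"
  shows "\<exists>(X :: nat monoid) \<phi>. group X \<and> finite (carrier X) \<and> \<phi> \<in> hom (pres_group r) X \<and>
           \<phi> ` carrier (pres_group r) = carrier X \<and>
           \<not> conjugate_in X (\<phi> (word_class (word_eqv r) f)) (\<phi> (word_class (word_eqv r) g))"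
proof -
  obtain R where R: "word_cong R" "word_eqv r \<le> R" "finite (range (word_class R))"
    and nc: "\<And>h. \<not> R (f @ h) (h @ g)"
    using assms by (auto simp: separable_words_def)
  let ?E = "word_eqv r" let ?Q = "quotient_group R"
  note E = word_cong_word_eqv[of r]
  interpret Q: group ?Q by (rule group_quotient_group[OF R(1)])
  \<comment> \<open>Finiteness gives an injection into the naturals; \<open>image_group\<close>
    transports the group structure along it to the required type.\<close>
  obtain e :: "letter list set \<Rightarrow> nat" where e: "inj_on e (carrier ?Q)"
    using finite_imp_inj_to_nat_seg[of "carrier ?Q"] R carrier_quotient_group by metis
  define X where "X = image_group e ?Q"
  have iso: "e \<in> iso ?Q X" and gX: "group X"
    unfolding X_def using inj_imp_image_group_iso[OF e] Q.inj_imp_image_group_is_group[OF e] by auto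
  \<comment> \<open>Saturation under the coarser \<open>R\<close> turns a class of
    \<open>word_eqv r\<close> into the \<open>R\<close>-class containing it, without choosing
    representatives.\<close>
  define \<psi> where "\<psi> A = {w. \<exists>u\<in>A. R u w}" for A
  have \<psi>: "\<psi> (word_class ?E w) = word_class R w" for w
  proof -
    have "R w u" if "?E w u" for u using that R(2) by blast
    then show ?thesis unfolding \<psi>_def word_class_def
      using R_trans[OF R(1)] R_refl[OF E] by blast
  qed
  have hom\<psi>: "\<psi> \<in> hom (pres_group r) ?Q"
    by (rule homI) (auto simp: pres_group_eq carrier_quotient_group[OF E] carrier_quotient_group[OF R(1)]
        mult_quotient_group[OF E] mult_quotient_group[OF R(1)] \<psi>)
  have im\<psi>: "\<psi> ` carrier (pres_group r) = carrier ?Q"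
    by (auto simp: pres_group_eq carrier_quotient_group[OF E] carrier_quotient_group[OF R(1)] \<psi> image_image)
  have ehom: "e \<in> hom ?Q X" and bij: "bij_betw e (carrier ?Q) (carrier X)"
    using iso by (auto simp: iso_def)
  interpret eh: group_hom ?Q X e
    using ehom gX by (simp add: group_hom_def group_hom_axioms_def Q.group_axioms)
  have mem: "word_class R w \<in> carrier ?Q" for w by (simp add: carrier_quotient_group[OF R(1)])
  have "\<not> conjugate_in X (e (word_class R f)) (e (word_class R g))"
  proof
    assume "conjugate_in X (e (word_class R f)) (e (word_class R g))"
    then obtain x where x: "x \<in> carrier X" "e (word_class R g) = inv\<^bsub>X\<^esub> x \<otimes>\<^bsub>X\<^esub> e (word_class R f) \<otimes>\<^bsub>X\<^esub> x"
      by (auto simp: conjugate_in_def)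
    then obtain y where y: "y \<in> carrier ?Q" "x = e y"
      using bij by (auto simp: bij_betw_def)
    then have "e (word_class R g) = e (inv\<^bsub>?Q\<^esub> y \<otimes>\<^bsub>?Q\<^esub> word_class R f \<otimes>\<^bsub>?Q\<^esub> y)"
      using x mem by simp
    then have "word_class R g = inv\<^bsub>?Q\<^esub> y \<otimes>\<^bsub>?Q\<^esub> word_class R f \<otimes>\<^bsub>?Q\<^esub> y"
      using inj_onD[OF e] y mem by (metis Q.m_closed Q.inv_closed)
    then have "conjugate_in ?Q (word_class R f) (word_class R g)"
      using y by (auto simp: conjugate_in_def)
    then show False using nc conjugate_in_quotient_group[OF R(1)] by blast
  qed
  moreover have "finite (carrier X)"
    using R(3) bij carrier_quotient_group[OF R(1)] bij_betw_finite by metis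
  moreover have "e \<circ> \<psi> \<in> hom (pres_group r) X" using hom\<psi> ehom hom_compose by blast
  moreover have "(e \<circ> \<psi>) ` carrier (pres_group r) = carrier X"
    using im\<psi> bij by (metis bij_betw_def image_comp)
  ultimately show ?thesis
    using gX \<psi> by (intro exI[of _ X] exI[of _ "e \<circ> \<psi>"]) auto
qed

lemma separable_words_sym:
  assumes "separable_words r f g" shows "separable_words r g f"
proof -
  obtain R where R: "word_cong R" "word_eqv r \<le> R" "finite (range (word_class R))"
    and nc: "\<And>h. \<not> R (f @ h) (h @ g)"
    using assms by (auto simp: separable_words_def)
  note tr = R_trans[OF R(1)] and ap = R_append[OF R(1)] and rf = R_refl[OF R(1)]
  have "\<not> R (g @ h) (h @ f)" for h
  proof
    assume "R (g @ h) (h @ f)"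
    then have "R (inv_word h @ (g @ h) @ inv_word h) (inv_word h @ (h @ f) @ inv_word h)"
      by (rule ap[OF rf ap[OF _ rf]])
    moreover have "R (inv_word h @ (h @ f) @ inv_word h) (f @ inv_word h)"
      using ap[OF R_inv_left[OF R(1), of h] rf[of "f @ inv_word h"]] by simp
    moreover have "R (inv_word h @ (g @ h) @ inv_word h) (inv_word h @ g)"
      using ap[OF rf[of "inv_word h @ g"] R_inv_right[OF R(1), of h]] by simp
    ultimately have "R (f @ inv_word h) (inv_word h @ g)"
      by (blast intro: tr R_sym[OF R(1)])
    then show False using nc by blast
  qed
  then show ?thesis using R by (auto simp: separable_words_def)
qed

definition conj_words :: "letter list \<Rightarrow> letter list \<Rightarrow> letter list \<Rightarrow> bool" where
  "conj_words r f g \<longleftrightarrow> (\<exists>h. word_eqv r (f @ h) (h @ g))"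

text \<open>A conjugator \<open>k\<close> from \<open>f\<close> to \<open>f'\<close> survives in
  every quotient; if \<open>h\<close> took \<open>f\<close> to \<open>g\<close> there,
  \<open>inv_word k @ h\<close> would take \<open>f'\<close> to \<open>g\<close>.\<close>

lemma separable_words_conj:
  assumes "separable_words r f' g" "conj_words r f f'" shows "separable_words r f g"
proof -
  obtain R where R: "word_cong R" "word_eqv r \<le> R" "finite (range (word_class R))"
    and nc: "\<And>h. \<not> R (f' @ h) (h @ g)"
    using assms by (auto simp: separable_words_def)
  obtain k where "word_eqv r (f @ k) (k @ f')" using assms(2) by (auto simp: conj_words_def)
  then have k: "R (f @ k) (k @ f')" using R(2) by blast
  note tr = R_trans[OF R(1)] and ap = R_append[OF R(1)] and rf = R_refl[OF R(1)] and sy = R_sym[OF R(1)]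
  have "\<not> R (f @ h) (h @ g)" for h
  proof
    assume h: "R (f @ h) (h @ g)"
    have "R (f' @ inv_word k @ h) (inv_word k @ (k @ f') @ inv_word k @ h)"
      using sy[OF ap[OF R_inv_left[OF R(1), of k] rf[of "f' @ inv_word k @ h"]]] by simp
    moreover have "R (inv_word k @ (k @ f') @ inv_word k @ h) (inv_word k @ (f @ k) @ inv_word k @ h)"
      by (rule ap[OF rf ap[OF sy[OF k] rf]])
    moreover have "R (inv_word k @ (f @ k) @ inv_word k @ h) (inv_word k @ f @ h)"
      using ap[OF rf[of "inv_word k @ f"] ap[OF R_inv_right[OF R(1), of k] rf[of h]]] by simp
    moreover have "R (inv_word k @ f @ h) (inv_word k @ h @ g)"
      by (rule ap[OF rf h])
    ultimately have "R (f' @ inv_word k @ h) (inv_word k @ h @ g)"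
      by (blast intro: tr)
    then have "R (f' @ (inv_word k @ h)) ((inv_word k @ h) @ g)" by simp
    then show False using nc by blast
  qed
  then show ?thesis using R by (auto simp: separable_words_def)
qed

subsection \<open>Syllables\<close>

definition pw :: "bool \<Rightarrow> int \<Rightarrow> letter list" where
  "pw g p = replicate (nat \<bar>p\<bar>) (g, 0 \<le> p)"

text \<open>An item \<open>(t, A, B)\<close> is a syllable of the \<open>t\<close>-th generator followed by an element of
  \<open>\<langle>a\<^sup>m, b\<^sup>n\<rangle>\<close>, whose part in the same generator is absorbed into the syllable.\<close>

type_synonym item = "bool \<times> int \<times> int"

fun item_word :: "item \<Rightarrow> letter list" where
  "item_word (t, A, B) = (if t then pw True B @ pw False A else pw False A @ pw True B)"

definition list_word :: "item list \<Rightarrow> letter list" where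
  "list_word L = concat (map item_word L)"

lemma list_word_simps [simp]:
  "list_word [] = []" "list_word (x # L) = item_word x @ list_word L"
  "list_word (K @ L) = list_word K @ list_word L"
  by (auto simp: list_word_def)

abbreviation exp_a :: "item \<Rightarrow> int" where "exp_a x \<equiv> fst (snd x)"
abbreviation exp_b :: "item \<Rightarrow> int" where "exp_b x \<equiv> snd (snd x)"

definition sgn_letter :: "letter \<Rightarrow> int" where
  "sgn_letter x = (if snd x then 1 else - 1)"

definition da :: "letter \<Rightarrow> int" where
  "da x = (if fst x then 0 else sgn_letter x)"

definition db :: "letter \<Rightarrow> int" where
  "db x = (if fst x then sgn_letter x else 0)"

definition ea :: "letter list \<Rightarrow> int" where "ea w = sum_list (map da w)"
definition eb :: "letter list \<Rightarrow> int" where "eb w = sum_list (map db w)"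

lemma ea_simps [simp]: "ea [] = 0" "ea (x # w) = da x + ea w" "ea (u @ w) = ea u + ea w"
  by (auto simp: ea_def)

lemma eb_simps [simp]: "eb [] = 0" "eb (x # w) = db x + eb w" "eb (u @ w) = eb u + eb w"
  by (auto simp: eb_def)

lemma da_flip [simp]: "da (flip x) = - da x"
  by (simp add: da_def flip_def sgn_letter_def)

lemma db_flip [simp]: "db (flip x) = - db x"
  by (simp add: db_def flip_def sgn_letter_def)

lemma ea_inv_word [simp]: "ea (inv_word w) = - ea w"
  by (induction w) (auto simp: inv_word_def)

lemma eb_inv_word [simp]: "eb (inv_word w) = - eb w"
  by (induction w) (auto simp: inv_word_def)

lemma ea_pw [simp]: "ea (pw g p) = (if g then 0 else p)"
  by (simp add: ea_def pw_def sum_list_replicate da_def sgn_letter_def)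

lemma eb_pw [simp]: "eb (pw g p) = (if g then p else 0)"
  by (simp add: eb_def pw_def sum_list_replicate db_def sgn_letter_def)

lemma ea_list_word: "ea (list_word L) = sum_list (map exp_a L)"
  by (induction L) auto

lemma eb_list_word: "eb (list_word L) = sum_list (map exp_b L)"
  by (induction L) auto

lemma comm_relator_pw:
  "comm_relator m n = pw False (- int m) @ pw True (- int n) @ pw False (int m) @ pw True (int n)"
proof -
  have "replicate k (g, False) = pw g (- int k)" for k g
    by (cases "k = 0") (auto simp: pw_def)
  then show ?thesis
    by (simp add: comm_relator_def flip_def pw_def)
qed

text \<open>A shift by one trades the term at 0 for the equal term at \<open>M\<close>; induction
  over the integers in both directions gives every shift. This makes the trace translation
  invariant.\<close>

lemma sum_periodic_shift:
  fixes F :: "int \<Rightarrow> int"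
  assumes per: "\<And>i. F (i + M) = F i" and "M > 0"
  shows "(\<Sum>i\<in>{0..<M}. F (i + p)) = sum F {0..<M}"
proof -
  have step: "(\<Sum>i\<in>{0..<M}. H (i + 1)) = sum H {0..<M}" if "\<And>i. H (i + M) = H i" for H :: "int \<Rightarrow> int"
  proof -
    have "(\<Sum>i\<in>{0..<M}. H (i + 1)) = sum H {1..<M + 1}"
      by (rule sum.reindex_bij_witness[of _ "\<lambda>i. i - 1" "\<lambda>i. i + 1"]) auto
    moreover have "insert 0 {1..<M + 1} = insert M {0..<M}" using \<open>M > 0\<close> by auto
    then have "sum H (insert 0 {1..<M + 1}) = sum H (insert M {0..<M})" by simp
    then have "H 0 + sum H {1..<M + 1} = H M + sum H {0..<M}" by simp
    moreover have "H M = H 0" using that[of 0] by simp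
    ultimately show ?thesis by simp
  qed
  show ?thesis
  proof (induction p rule: int_induct[of _ 0])
    case base show ?case by simp
  next
    case (step1 p)
    have "F (i + M + p) = F (i + p)" for i using per[of "i + p"] by (simp add: ac_simps)
    from step[of "\<lambda>i. F (i + p)", OF this] step1(2) show ?case by (simp add: ac_simps)
  next
    case (step2 p)
    have "F (i + M + (p - 1)) = F (i + (p - 1))" for i
      using per[of "i + (p - 1)"] by (simp add: algebra_simps)
    from step[of "\<lambda>i. F (i + (p - 1))", OF this] step2(2) show ?case by (simp add: algebra_simps)
  qed
qed

subsection \<open>The hop machine of a cyclically reduced word\<close>

text \<open>The syllables \<open>(ty v, A v, B v)\<close> are indexed periodically, and all data are invariant under the lattice
  generated by \<open>(M, 0, 0)\<close>, \<open>(0, N, 0)\<close> and \<open>(I k, J k, k)\<close>, where \<open>I k\<close> and \<open>J k\<close> are the exponent sums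
  of one period. Keeping positions in \<open>nat\<close> avoids a case distinction at the wrap-around.\<close>

locale hop_machine =
  fixes m n M N :: int and k :: nat and ty :: "nat \<Rightarrow> bool" and A B :: "nat \<Rightarrow> int"
  assumes dvd_M: "m dvd M" and dvd_N: "n dvd N" and M_pos: "M > 0" and N_pos: "N > 0"
    and k_pos: "k > 0"
    and ty_per: "ty (v + k) = ty v" and A_per: "A (v + k) = A v" and B_per: "B (v + k) = B v"
    and type_a: "\<not> ty v \<Longrightarrow> \<not> m dvd A v \<and> n dvd B v"
    and type_b: "ty v \<Longrightarrow> \<not> n dvd B v \<and> m dvd A v"
    and adj_a: "\<not> ty v \<Longrightarrow> \<not> ty (Suc v) \<Longrightarrow> \<not> N dvd B v"
    and adj_b: "ty v \<Longrightarrow> ty (Suc v) \<Longrightarrow> \<not> M dvd A v"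
    and ex_type: "\<exists>v<k. ty v = t"
begin

definition I :: "nat \<Rightarrow> int" where "I v = (\<Sum>u<v. A u)"
definition J :: "nat \<Rightarrow> int" where "J v = (\<Sum>u<v. B u)"

lemma I_simps [simp]: "I 0 = 0" "I (Suc v) = I v + A v" by (auto simp: I_def)
lemma J_simps [simp]: "J 0 = 0" "J (Suc v) = J v + B v" by (auto simp: J_def)

lemma I_per: "I (v + k) = I v + I k"
  by (induction v) (auto simp: A_per)

lemma J_per: "J (v + k) = J v + J k"
  by (induction v) (auto simp: B_per)

text \<open>The gate is open where the exponents agree with \<open>(I v, J v)\<close>, those reached
  before the \<open>v\<close>-th syllable. In the coordinate of the syllable's own generator
  agreement is only modulo \<open>m\<close> or \<open>n\<close>, in the other one modulo the full
  period.\<close>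

definition gate :: "bool \<Rightarrow> int \<Rightarrow> int \<Rightarrow> nat \<Rightarrow> int" where
  "gate g i j v = (if ty v = g \<and> (if g then M else m) dvd (i - I v) \<and> (if g then n else N) dvd (j - J v)
     then 1 else 0)"

text \<open>First-order part of \<open>(1 + E) T (1 - E)\<close>, where \<open>T\<close> is the
  translation by the letter and \<open>E\<close> moves \<open>v\<close> to \<open>v + 1\<close> with
  weight \<open>gate\<close>. The second-order part and the square of \<open>E\<close> vanish by
  \<open>gate_orth\<close>.\<close>

definition hop :: "letter \<Rightarrow> int \<Rightarrow> int \<Rightarrow> nat \<Rightarrow> int" where
  "hop x i j v = gate (fst x) i j v - gate (fst x) (i + da x) (j + db x) v"

text \<open>\<open>coeff w d i j v\<close> is the matrix entry of \<open>w\<close> from the state \<open>(i, j, v)\<close> to \<open>(i + ea w, j + eb w, v + d)\<close>,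
  i.e. the signed number of ways to read \<open>w\<close> with exactly \<open>d\<close> hops; all other entries vanish.\<close>

primrec coeff :: "letter list \<Rightarrow> nat \<Rightarrow> int \<Rightarrow> int \<Rightarrow> nat \<Rightarrow> int" where
  "coeff [] = (\<lambda>d i j v. if d = 0 then 1 else 0)"
| "coeff (x # w) = (\<lambda>d i j v. coeff w d (i + da x) (j + db x) v +
     (if d = 0 then 0 else hop x i j v) * coeff w (d - 1) (i + da x) (j + db x) (Suc v))"

text \<open>Two consecutive hops of the same generator are impossible: by cyclic reducedness the other coordinate
  would have to change in between. This is what makes the unipotent maps square to zero.\<close>

lemma gate_orth:
  assumes "if g then i = i' else j = j'"
  shows "gate g i j v * gate g i' j' (Suc v) = 0"
proof -
  have "N dvd B v" if "N dvd j - J v" "N dvd j - (J v + B v)"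
    using dvd_diff[OF that] by simp
  moreover have "M dvd A v" if "M dvd i - I v" "M dvd i - (I v + A v)"
    using dvd_diff[OF that] by simp
  ultimately show ?thesis
    using assms adj_a[of v] adj_b[of v] by (cases g) (auto simp: gate_def)
qed

lemma gate_diff_orth:
  assumes "if g then i1 = i3 \<and> i1 = i4 \<and> i2 = i3 \<and> i2 = i4 else j1 = j3 \<and> j1 = j4 \<and> j2 = j3 \<and> j2 = j4"
  shows "(gate g i1 j1 v - gate g i2 j2 v) * ((gate g i3 j3 (Suc v) - gate g i4 j4 (Suc v)) * z) = 0"
proof -
  have "gate g i1 j1 v * gate g i3 j3 (Suc v) = 0"
    by (rule gate_orth) (use assms in \<open>simp split: if_splits\<close>)
  moreover have "gate g i1 j1 v * gate g i4 j4 (Suc v) = 0"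
    by (rule gate_orth) (use assms in \<open>simp split: if_splits\<close>)
  moreover have "gate g i2 j2 v * gate g i3 j3 (Suc v) = 0"
    by (rule gate_orth) (use assms in \<open>simp split: if_splits\<close>)
  moreover have "gate g i2 j2 v * gate g i4 j4 (Suc v) = 0"
    by (rule gate_orth) (use assms in \<open>simp split: if_splits\<close>)
  ultimately show ?thesis by (auto simp: algebra_simps)
qed

text \<open>The hop on the way back is the negative of the hop on the way out, and hopping twice has
  weight zero.\<close>

lemma coeff_cancel: "coeff (x # flip x # w) = coeff w"
proof (intro ext)
  fix d i j v
  let ?i = "i + da x" and ?j = "j + db x"
  have f: "fst (flip x) = fst x" by (simp add: flip_def)
  have o: "hop x i j v * (hop (flip x) ?i ?j (Suc v) * c) = 0" for c
    unfolding hop_def f by (rule gate_diff_orth) (auto simp: da_def db_def sgn_letter_def flip_def)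
  have s: "hop (flip x) ?i ?j v = - hop x i j v"
    by (simp add: hop_def) (simp add: flip_def)
  have "coeff (x # flip x # w) d i j v = coeff w d i j v + (if d = 0 \<or> d - 1 = 0 then 0 else
      hop x i j v * (hop (flip x) ?i ?j (Suc v) * coeff w (d - 1 - 1) i j (Suc (Suc v))))"
    by (simp add: s algebra_simps)
  then show "coeff (x # flip x # w) d i j v = coeff w d i j v"
    unfolding o by simp
qed

lemma coeff_append_cong: "coeff u = coeff v \<Longrightarrow> coeff (p @ u) = coeff (p @ v)"
  by (induction p) simp_all

text \<open>Gate differences along a power telescope and products of two of them vanish, so a whole
  power hops at most once, with a weight that depends on its end points only.\<close>

lemma coeff_replicate:
  "coeff (replicate c (g, e) @ w) d i j v =
     (let i' = i + int c * da (g, e); j' = j + int c * db (g, e) in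
      coeff w d i' j' v + (if d = 0 then 0 else gate g i j v - gate g i' j' v) * coeff w (d - 1) i' j' (Suc v))"
proof (induction c arbitrary: d i j v)
  case (Suc c)
  let ?p = "int c * da (g, e)" and ?q = "int c * db (g, e)"
  let ?i = "i + da (g, e)" and ?j = "j + db (g, e)"
  have o: "hop (g, e) i j v * ((gate g ?i ?j (Suc v) - gate g (?i + ?p) (?j + ?q) (Suc v)) * z) = 0" for z
    unfolding hop_def fst_conv by (rule gate_diff_orth) (auto simp: da_def db_def)
  have "coeff (replicate (Suc c) (g, e) @ w) d i j v =
      coeff w d (?i + ?p) (?j + ?q) v
      + (if d = 0 then 0 else gate g ?i ?j v - gate g (?i + ?p) (?j + ?q) v) * coeff w (d - 1) (?i + ?p) (?j + ?q) (Suc v)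
      + (if d = 0 then 0 else hop (g, e) i j v) * coeff w (d - 1) (?i + ?p) (?j + ?q) (Suc v)
      + (if d = 0 \<or> d - 1 = 0 then 0 else hop (g, e) i j v *
        ((gate g ?i ?j (Suc v) - gate g (?i + ?p) (?j + ?q) (Suc v)) * coeff w (d - 1 - 1) (?i + ?p) (?j + ?q) (Suc (Suc v))))"
    by (simp add: Suc Let_def distrib_left)
  also have "\<dots> = coeff w d (?i + ?p) (?j + ?q) v
      + (if d = 0 then 0 else gate g i j v - gate g (?i + ?p) (?j + ?q) v) * coeff w (d - 1) (?i + ?p) (?j + ?q) (Suc v)"
    unfolding o by (simp add: hop_def algebra_simps)
  finally show ?case by (simp add: Let_def algebra_simps)
qed (simp add: Let_def)

lemma coeff_pw:
  "coeff (pw g p @ w) d i j v =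
     (let i' = (if g then i else i + p); j' = (if g then j + p else j) in
      coeff w d i' j' v + (if d = 0 then 0 else gate g i j v - gate g i' j' v) * coeff w (d - 1) i' j' (Suc v))"
  unfolding pw_def coeff_replicate
  by (cases "p \<ge> 0") (auto simp: da_def db_def sgn_letter_def)

lemma dvd_add_shift: "(d::int) dvd p \<Longrightarrow> d dvd (i + p - c) \<longleftrightarrow> d dvd (i - c)"
  by (metis add.commute add_diff_eq dvd_add_right_iff)

lemma gate_shift_a: "m dvd p \<Longrightarrow> gate False (i + p) j v = gate False i j v"
  by (simp add: gate_def dvd_add_shift)

lemma gate_shift_b: "n dvd p \<Longrightarrow> gate True i (j + p) v = gate True i j v"
  by (simp add: gate_def dvd_add_shift)

lemma gate_per_M: "M dvd p \<Longrightarrow> gate g (i + p) j v = gate g i j v"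
  using dvd_M dvd_trans by (auto simp: gate_def dvd_add_shift)

lemma gate_per_N: "N dvd p \<Longrightarrow> gate g i (j + p) v = gate g i j v"
  using dvd_N dvd_trans by (auto simp: gate_def dvd_add_shift)

lemma gate_per_k: "gate g (i + I k) (j + J k) (v + k) = gate g i j v"
  by (simp add: gate_def ty_per I_per J_per)

lemma coeff_per_M: "M dvd p \<Longrightarrow> coeff w d (i + p) j v = coeff w d i j v"
proof (induction w arbitrary: d i j v)
  case (Cons x w)
  have e: "i + p + da x = i + da x + p" by simp
  show ?case using Cons by (simp add: e hop_def gate_per_M)
qed simp

lemma coeff_per_N: "N dvd p \<Longrightarrow> coeff w d i (j + p) v = coeff w d i j v"
proof (induction w arbitrary: d i j v)
  case (Cons x w)
  have e: "j + p + db x = j + db x + p" by simp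
  show ?case using Cons by (simp add: e hop_def gate_per_N)
qed simp

lemma coeff_per_k: "coeff w d (i + I k) (j + J k) (v + k) = coeff w d i j v"
proof (induction w arbitrary: d i j v)
  case (Cons x w)
  have e: "i + I k + da x = i + da x + I k" "j + J k + db x = j + db x + J k" by auto
  have s: "Suc (v + k) = Suc v + k" by simp
  show ?case using Cons by (simp add: e s hop_def gate_per_k del: add_Suc)
qed simp

lemma coeff_pw_a: "m dvd p \<Longrightarrow> coeff (pw False p @ w) d i j v = coeff w d (i + p) j v"
  by (simp add: coeff_pw gate_shift_a Let_def)

lemma coeff_pw_b: "n dvd p \<Longrightarrow> coeff (pw True p @ w) d i j v = coeff w d i (j + p) v"
  by (simp add: coeff_pw gate_shift_b Let_def)

text \<open>Three ways to make the relator act trivially: one of the two powers acts as the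
  identity, or both act as pure translations. Words of a single syllable type will use the first
  two, mixed ones the third.\<close>

definition relator_ok :: "nat \<Rightarrow> nat \<Rightarrow> bool" where
  "relator_ok m0 n0 \<longleftrightarrow> M dvd int m0 \<or> N dvd int n0 \<or> (m dvd int m0 \<and> n dvd int n0)"

lemma coeff_pw_cancel: "coeff (pw g (- p) @ pw g p @ w) = coeff w"
proof (intro ext)
  fix d i j v
  let ?i = "if g then i else i - p" and ?j = "if g then j - p else j"
  have o: "(gate g i j v - gate g ?i ?j v) * ((gate g ?i ?j (Suc v) - gate g i j (Suc v)) * z) = 0" for z
    by (rule gate_diff_orth) simp
  have "coeff (pw g (- p) @ pw g p @ w) d i j v = coeff w d i j v
    + (if d = 0 \<or> d - 1 = 0 then 0 else
       (gate g i j v - gate g ?i ?j v) * ((gate g ?i ?j (Suc v) - gate g i j (Suc v)) * coeff w (d - 1 - 1) i j (Suc (Suc v))))"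
    by (cases g) (simp_all add: coeff_pw Let_def distrib_left, simp_all add: algebra_simps)
  then show "coeff (pw g (- p) @ pw g p @ w) d i j v = coeff w d i j v"
    unfolding o by simp
qed

lemma coeff_comm_relator:
  assumes "relator_ok m0 n0"
  shows "coeff (comm_relator m0 n0 @ w) = coeff w"
  using assms unfolding relator_ok_def
proof (elim disjE conjE)
  assume "M dvd int m0"
  moreover from this have "m dvd int m0" using dvd_M dvd_trans by blast
  ultimately have "coeff (pw False (int m0) @ w) = coeff w" "coeff (pw False (- int m0) @ w) = coeff w" for w
    using coeff_pw_a[of "int m0" w] coeff_pw_a[of "- int m0" w] coeff_per_M[of "int m0"] coeff_per_M[of "- int m0"]
    by (auto simp: fun_eq_iff)
  then show ?thesis
    unfolding comm_relator_pw using coeff_append_cong coeff_pw_cancel by (metis append_assoc)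
next
  assume "N dvd int n0"
  moreover from this have "n dvd int n0" using dvd_N dvd_trans by blast
  ultimately have *: "coeff (pw True (int n0) @ w) = coeff w" "coeff (pw True (- int n0) @ w) = coeff w" for w
    using coeff_pw_b[of "int n0" w] coeff_pw_b[of "- int n0" w] coeff_per_N[of "int n0"] coeff_per_N[of "- int n0"]
    by (auto simp: fun_eq_iff)
  have "coeff (pw False (- int m0) @ pw True (- int n0) @ pw False (int m0) @ pw True (int n0) @ w)
      = coeff (pw False (- int m0) @ pw False (int m0) @ w)"
    by (rule coeff_append_cong) (metis * coeff_append_cong)
  then show ?thesis
    unfolding comm_relator_pw by (simp add: coeff_pw_cancel)
next
  assume "m dvd int m0" "n dvd int n0"
  then show ?thesis
    unfolding comm_relator_pw by (auto simp: fun_eq_iff coeff_pw_a coeff_pw_b)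
qed

lemma coeff_word_eqv:
  assumes "relator_ok m0 n0" "word_eqv (comm_relator m0 n0) u v"
  shows "coeff u = coeff v"
  using assms(2)
proof (induction rule: word_eqv.induct)
  case (cancel u x v)
  show ?case by (rule coeff_append_cong) (metis coeff_cancel append_Cons append_Nil)
next
  case (relator u v)
  show ?case by (rule coeff_append_cong) (rule coeff_comm_relator[OF assms(1)])
qed auto

text \<open>\<open>coeff\<close> recurses at the front of a word; moving a letter to the end
  requires the expansion at the back.\<close>

lemma coeff_snoc:
  "coeff (w @ [x]) d i j v = coeff w d i j v +
     (if d = 0 then 0 else coeff w (d - 1) i j v * hop x (i + ea w) (j + eb w) (v + (d - 1)))"
proof (induction w arbitrary: d i j v)
  case (Cons y w)
  consider "d = 0" | "d = 1" | d' where "d = Suc (Suc d')"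
    by (metis One_nat_def not0_implies_Suc)
  then show ?case
    by cases (simp_all add: Cons algebra_simps)
next
  case Nil
  show ?case by (cases "d = 1") auto
qed

section \<open>The trace over a fundamental domain of the lattice of periods\<close>

definition total :: "(int \<Rightarrow> int \<Rightarrow> nat \<Rightarrow> int) \<Rightarrow> int" where
  "total F = (\<Sum>i\<in>{0..<M}. \<Sum>j\<in>{0..<N}. \<Sum>v<k. F i j v)"

definition periodic :: "(int \<Rightarrow> int \<Rightarrow> nat \<Rightarrow> int) \<Rightarrow> bool" where
  "periodic F \<longleftrightarrow> (\<forall>i j v. F (i + M) j v = F i j v \<and> F i (j + N) v = F i j v \<and>
     F (i + I k) (j + J k) (v + k) = F i j v)"

lemma total_add: "total (\<lambda>i j v. F i j v + G i j v) = total F + total G"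
  by (simp add: total_def sum.distrib)

lemma total_shift_ab:
  assumes "periodic F"
  shows "total (\<lambda>i j v. F (i + p) (j + q) v) = total F"
proof -
  have "(\<Sum>i\<in>{0..<M}. \<Sum>j\<in>{0..<N}. \<Sum>v<k. F (i + p) (j + q) v) =
      (\<Sum>i\<in>{0..<M}. (\<Sum>j\<in>{0..<N}. \<Sum>v<k. F i (j + q) v))"
    using assms M_pos
    by (intro sum_periodic_shift[where F = "\<lambda>i. \<Sum>j\<in>{0..<N}. \<Sum>v<k. F i (j + q) v"])
       (simp_all add: periodic_def)
  also have "\<dots> = (\<Sum>i\<in>{0..<M}. (\<Sum>j\<in>{0..<N}. \<Sum>v<k. F i j v))"
  proof (rule sum.cong[OF HOL.refl]) \<comment> \<open>plain \<open>refl\<close> is hidden by the rule of \<open>word_eqv\<close>\<close>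
    fix i
    show "(\<Sum>j\<in>{0..<N}. \<Sum>v<k. F i (j + q) v) = (\<Sum>j\<in>{0..<N}. \<Sum>v<k. F i j v)"
      using assms N_pos by (intro sum_periodic_shift[where F = "\<lambda>j. \<Sum>v<k. F i j v"])
        (simp_all add: periodic_def)
  qed
  finally show ?thesis by (simp add: total_def)
qed

text \<open>The shift replaces layer 0 by layer \<open>k\<close>. The period
  \<open>(I k, J k, k)\<close> identifies these up to a translation of \<open>i\<close> and
  \<open>j\<close>, which does not change the sums.\<close>

lemma total_shift_pos:
  assumes F: "periodic F"
  shows "total (\<lambda>i j v. F i j (Suc v)) = total F"
proof -
  have swap: "total H = (\<Sum>v<k. \<Sum>i\<in>{0..<M}. \<Sum>j\<in>{0..<N}. H i j v)" for H
  proof -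
    have "total H = (\<Sum>i\<in>{0..<M}. \<Sum>v<k. \<Sum>j\<in>{0..<N}. H i j v)"
      unfolding total_def by (intro sum.cong HOL.refl sum.swap)
    also have "\<dots> = (\<Sum>v<k. \<Sum>i\<in>{0..<M}. \<Sum>j\<in>{0..<N}. H i j v)" by (rule sum.swap)
    finally show ?thesis .
  qed
  define S where "S v = (\<Sum>i\<in>{0..<M}. \<Sum>j\<in>{0..<N}. F i j v)" for v
  have "S 0 = (\<Sum>i\<in>{0..<M}. \<Sum>j\<in>{0..<N}. F (i + I k) (j + J k) k)"
    using F[unfolded periodic_def, rule_format, of _ _ 0] unfolding S_def by simp
  also have "\<dots> = (\<Sum>i\<in>{0..<M}. \<Sum>j\<in>{0..<N}. F i (j + J k) k)"
    using F M_pos by (intro sum_periodic_shift[where F = "\<lambda>i. \<Sum>j\<in>{0..<N}. F i (j + J k) k"])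
      (simp_all add: periodic_def)
  also have "\<dots> = S k"
    unfolding S_def
  proof (rule sum.cong[OF HOL.refl])
    fix i
    show "(\<Sum>j\<in>{0..<N}. F i (j + J k) k) = (\<Sum>j\<in>{0..<N}. F i j k)"
      using F N_pos by (intro sum_periodic_shift[where F = "\<lambda>j. F i j k"]) (simp_all add: periodic_def)
  qed
  finally have "S 0 = S k" .
  moreover have "S 0 + (\<Sum>v<k. S (Suc v)) = (\<Sum>v<k. S v) + S k"
    using sum.lessThan_Suc_shift[of S k] by simp
  ultimately show ?thesis by (simp add: swap S_def)
qed

lemma hop_per:
  "hop x (i + M) j v = hop x i j v" "hop x i (j + N) v = hop x i j v"
  "hop x (i + I k) (j + J k) (v + k) = hop x i j v"
proof -
  show "hop x (i + M) j v = hop x i j v"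
    using gate_per_M[of M] by (simp add: hop_def add.assoc add.commute[of M])
       (simp add: add.assoc[symmetric])
  show "hop x i (j + N) v = hop x i j v"
    using gate_per_N[of N] by (simp add: hop_def add.assoc add.commute[of N])
       (simp add: add.assoc[symmetric])
  have e: "i + I k + da x = i + da x + I k" "j + J k + db x = j + db x + J k" by auto
  show "hop x (i + I k) (j + J k) (v + k) = hop x i j v"
    unfolding hop_def e gate_per_k ..
qed

lemma periodic_coeff: "periodic (\<lambda>i j v. coeff w d i j v)"
  by (simp add: periodic_def coeff_per_M coeff_per_N coeff_per_k)

text \<open>For words with exponent sums \<open>(I k, J k)\<close> the paths counted here are exactly the closed ones that wind once.\<close>

definition tau :: "letter list \<Rightarrow> int" where
  "tau w = total (coeff w k)"

text \<open>Paths are split by whether \<open>x\<close> hops. If not, \<open>x\<close> merely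
  translates them; if so, its hop moves from the start of the path to the end, and these differ by
  one period because of the exponent sums.\<close>

lemma tau_rotate1:
  assumes "ea (x # w) = I k" "eb (x # w) = J k"
  shows "tau (x # w) = tau (w @ [x])"
proof -
  obtain k' where k: "k = Suc k'" using k_pos by (cases k) auto
  \<comment> \<open>Weight of reading \<open>w\<close> with \<open>k - 1\<close> hops and then
    letting \<open>x\<close> make the last one.\<close>
  define G where "G i j v = coeff w k' i j v * hop x (i + ea w) (j + eb w) (v + k')" for i j v
  have G: "periodic G"
    unfolding periodic_def
  proof (intro allI conjI)
    fix i j v
    have "i + M + ea w = i + ea w + M" "j + N + eb w = j + eb w + N"
      "i + I k + ea w = i + ea w + I k" "j + J k + eb w = j + eb w + J k" "v + k + k' = v + k' + k"
      by auto
    then show "G (i + M) j v = G i j v" "G i (j + N) v = G i j v" "G (i + I k) (j + J k) (v + k) = G i j v"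
      unfolding G_def by (simp_all only: hop_per coeff_per_k coeff_per_M[OF dvd_refl] coeff_per_N[OF dvd_refl])
  qed
  \<comment> \<open>After \<open>x\<close> with a hop and \<open>w\<close> with \<open>k - 1\<close>
    hops, the state is the initial one moved by the period.\<close>
  have e: "i + da x + ea w = i + I k" "j + db x + eb w = j + J k" "Suc v + k' = v + k" for i j v
    using assms k by auto
  have "hop x i j v * coeff w k' (i + da x) (j + db x) (Suc v) = G (i + da x) (j + db x) (Suc v)" for i j v
    unfolding G_def e hop_per by simp
  then have "coeff (x # w) k = (\<lambda>i j v. coeff w k (i + da x) (j + db x) v + G (i + da x) (j + db x) (Suc v))"
    by (simp add: k)
  moreover have "G (i + I k) (j + J k) (Suc v + k) = G i j (Suc v)" for i j v
    using G unfolding periodic_def by blast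
  then have "periodic (\<lambda>i j v. G i j (Suc v))"
    using G by (simp add: periodic_def)
  ultimately have "tau (x # w) = total (coeff w k) + total G"
    using total_shift_ab[OF periodic_coeff, of w k "da x" "db x"] total_shift_pos[OF G]
      total_shift_ab[of "\<lambda>i j v. G i j (Suc v)" "da x" "db x"]
    by (simp add: tau_def total_add)
  moreover have "coeff (w @ [x]) k = (\<lambda>i j v. coeff w k i j v + G i j v)"
    by (intro ext) (simp add: coeff_snoc k G_def)
  ultimately show ?thesis by (simp add: tau_def total_add)
qed

lemma tau_append_commute:
  assumes "ea (u @ v) = I k" "eb (u @ v) = J k"
  shows "tau (u @ v) = tau (v @ u)"
  using assms
proof (induction u arbitrary: v)
  case (Cons x u)
  have "tau (x # (u @ v)) = tau ((u @ v) @ [x])"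
    by (rule tau_rotate1) (use Cons.prems in auto)
  also have "\<dots> = tau (u @ (v @ [x]))" by simp
  also have "\<dots> = tau ((v @ [x]) @ u)"
    by (rule Cons.IH) (use Cons.prems in auto)
  finally show ?case by simp
qed simp

subsection \<open>A finite quotient\<close>

context
  fixes q :: int assumes q: "q > 0"
begin

text \<open>Restriction to one fundamental domain and to at most \<open>k\<close> hops gives an
  element of a finite function space; by periodicity it still determines all coefficients with
  \<open>d \<le> k\<close> modulo \<open>q\<close>.\<close>

definition coeff_mod :: "letter list \<Rightarrow> nat \<times> int \<times> int \<times> nat \<Rightarrow> int" where
  "coeff_mod w = restrict (\<lambda>(d, i, j, v). coeff w d i j v mod q) ({..k} \<times> {0..<M} \<times> {0..<N} \<times> {..<k})"

lemma finite_range_coeff_mod: "finite (range coeff_mod)"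
proof (rule finite_subset)
  show "range coeff_mod \<subseteq> ({..k} \<times> {0..<M} \<times> {0..<N} \<times> {..<k}) \<rightarrow>\<^sub>E {0..<q}"
    using q by (auto simp: coeff_mod_def intro!: restrict_PiE_iff[THEN iffD2])
  show "finite (({..k} \<times> {0..<M} \<times> {0..<N} \<times> {..<k}) \<rightarrow>\<^sub>E {0..<q})"
    by (intro finite_PiE finite_cartesian_product) auto
qed

lemma coeff_reduce:
  "coeff w d i j v = coeff w d ((i - int (v div k) * I k) mod M) ((j - int (v div k) * J k) mod N) (v mod k)"
proof -
  have per: "coeff w d (i + int c * I k) (j + int c * J k) (v + c * k) = coeff w d i j v" for c i j v
  proof (induction c)
    case (Suc c)
    have "i + int (Suc c) * I k = i + int c * I k + I k" "j + int (Suc c) * J k = j + int c * J k + J k"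
      "v + Suc c * k = v + c * k + k" by (auto simp: algebra_simps)
    then show ?case using Suc by (simp only: coeff_per_k)
  qed simp
  let ?i = "i - int (v div k) * I k" and ?j = "j - int (v div k) * J k"
  have "coeff w d i j v = coeff w d ?i ?j (v mod k)"
    using per[of ?i "v div k" ?j "v mod k"] by (simp add: algebra_simps)
  also have "\<dots> = coeff w d (?i mod M + M * (?i div M)) (?j mod N + N * (?j div N)) (v mod k)"
    by simp
  also have "\<dots> = coeff w d (?i mod M) (?j mod N) (v mod k)"
    by (simp only: coeff_per_M coeff_per_N dvd_triv_left)
  finally show ?thesis .
qed

lemma coeff_mod_eq_iff:
  "coeff_mod u = coeff_mod w \<longleftrightarrow> (\<forall>d\<le>k. \<forall>i j v. coeff u d i j v mod q = coeff w d i j v mod q)"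
proof
  assume eq: "coeff_mod u = coeff_mod w"
  show "\<forall>d\<le>k. \<forall>i j v. coeff u d i j v mod q = coeff w d i j v mod q"
  proof (intro allI impI)
    fix d i j v assume "d \<le> k"
    have *: "coeff u d i j v mod q = coeff w d i j v mod q" if "i \<in> {0..<M}" "j \<in> {0..<N}" "v < k" for i j v
      using fun_cong[OF eq, of "(d, i, j, v)"] that \<open>d \<le> k\<close> by (simp add: coeff_mod_def)
    show "coeff u d i j v mod q = coeff w d i j v mod q"
      unfolding coeff_reduce[of _ d i j v] by (rule *) (use M_pos N_pos k_pos in auto)
  qed
qed (auto simp: coeff_mod_def fun_eq_iff)

text \<open>A letter in front consults only the coefficients at \<open>d\<close> and
  \<open>d - 1\<close>, so the bound \<open>d \<le> k\<close> is stable.\<close>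

lemma coeff_mod_append_left: "coeff_mod u = coeff_mod w \<Longrightarrow> coeff_mod (p @ u) = coeff_mod (p @ w)"
proof (induction p)
  case (Cons x p)
  then have *: "coeff (p @ u) d i j v mod q = coeff (p @ w) d i j v mod q" if "d \<le> k" for d i j v
    using that by (simp add: coeff_mod_eq_iff)
  show ?case
    unfolding coeff_mod_eq_iff
  proof (intro allI impI)
    fix d i j v assume d: "d \<le> k"
    show "coeff ((x # p) @ u) d i j v mod q = coeff ((x # p) @ w) d i j v mod q"
      unfolding append_Cons coeff.simps
      by (intro mod_add_cong mod_mult_cong * HOL.refl) (use d in auto)
  qed
qed simp

text \<open>\<open>coeff_mod\<close> is compatible with left multiplication only; quantifying over right contexts makes it
  two-sided without losing finiteness of the index.\<close>

definition coeff_equiv :: "letter list \<Rightarrow> letter list \<Rightarrow> bool" where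
  "coeff_equiv u w \<longleftrightarrow> (\<forall>p. coeff_mod (u @ p) = coeff_mod (w @ p))"

lemma coeff_mod_cong: "coeff u = coeff w \<Longrightarrow> coeff_mod u = coeff_mod w"
  by (simp add: coeff_mod_def)

lemma word_cong_coeff_equiv: "word_cong coeff_equiv"
  unfolding word_cong_def
proof (intro conjI allI impI)
  show "equivp coeff_equiv"
    by (rule equivpI) (auto simp: coeff_equiv_def reflp_def symp_def transp_def)
  show "coeff_equiv (u @ v) (u' @ v')" if "coeff_equiv u u'" "coeff_equiv v v'" for u u' v v'
    unfolding coeff_equiv_def
  proof
    fix p
    have "coeff_mod (u @ v @ p) = coeff_mod (u' @ v @ p)" using that(1) unfolding coeff_equiv_def by blast
    also have "\<dots> = coeff_mod (u' @ v' @ p)"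
      using that(2) unfolding coeff_equiv_def by (intro coeff_mod_append_left) blast
    finally show "coeff_mod ((u @ v) @ p) = coeff_mod ((u' @ v') @ p)" by simp
  qed
  show "coeff_equiv [x, flip x] []" for x
    unfolding coeff_equiv_def using coeff_mod_cong[OF coeff_cancel] by (simp del: coeff.simps)
qed

lemma word_eqv_le_coeff_equiv:
  assumes "relator_ok m0 n0"
  shows "word_eqv (comm_relator m0 n0) \<le> coeff_equiv"
proof (intro predicate2I)
  fix u w assume "word_eqv (comm_relator m0 n0) u w"
  then have "word_eqv (comm_relator m0 n0) (u @ p) (w @ p)" for p
    using word_eqv_context[of _ u w "[]" p] by simp
  then show "coeff_equiv u w"
    unfolding coeff_equiv_def using coeff_word_eqv[OF assms] coeff_mod_cong by blast
qed

lemma finite_range_word_class_coeff_equiv: "finite (range (word_class coeff_equiv))"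
proof -
  \<comment> \<open>Left multiplication by \<open>u\<close> induces a map on the finite set
    \<open>range coeff_mod\<close>; \<open>\<Phi> u\<close> is its graph and determines the class of
    \<open>u\<close>.\<close>
  define \<Phi> where "\<Phi> u = {(coeff_mod p, coeff_mod (u @ p)) | p. True}" for u
  have "coeff_equiv u w" if "\<Phi> u = \<Phi> w" for u w
    unfolding coeff_equiv_def
  proof
    fix p
    have "(coeff_mod p, coeff_mod (u @ p)) \<in> \<Phi> w" unfolding that[symmetric] by (auto simp: \<Phi>_def)
    then obtain p' where p': "coeff_mod p = coeff_mod p'" "coeff_mod (u @ p) = coeff_mod (w @ p')" by (auto simp: \<Phi>_def)
    then show "coeff_mod (u @ p) = coeff_mod (w @ p)" using coeff_mod_append_left by metis
  qed
  then have "word_class coeff_equiv u = word_class coeff_equiv (SOME w. \<Phi> w = \<Phi> u)" for u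
    using someI[of "\<lambda>w. \<Phi> w = \<Phi> u" u] word_class_eq_iff[OF word_cong_coeff_equiv] by auto
  then have "range (word_class coeff_equiv) \<subseteq> (\<lambda>X. word_class coeff_equiv (SOME w. \<Phi> w = X)) ` range \<Phi>"
    by blast
  moreover have "range \<Phi> \<subseteq> Pow (range coeff_mod \<times> range coeff_mod)"
    by (auto simp: \<Phi>_def)
  then have "finite (range \<Phi>)"
    by (rule finite_subset) (simp add: finite_range_coeff_mod)
  ultimately show ?thesis by (rule finite_surj[rotated])
qed

lemma sum_mod_cong:
  fixes F H :: "'b \<Rightarrow> int"
  assumes "\<And>x. x \<in> S \<Longrightarrow> F x mod q = H x mod q"
  shows "sum F S mod q = sum H S mod q"
proof -
  have "(\<Sum>x\<in>S. F x mod q) = (\<Sum>x\<in>S. H x mod q)"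
    using assms by (rule sum.cong[OF HOL.refl])
  then show ?thesis by (metis mod_sum_eq)
qed

lemma tau_mod_cong: "coeff_mod u = coeff_mod w \<Longrightarrow> tau u mod q = tau w mod q"
  unfolding tau_def total_def by (intro sum_mod_cong) (simp add: coeff_mod_eq_iff)

text \<open>\<open>tau\<close> modulo \<open>q\<close> depends only on the class in the finite
  quotient, and cyclic invariance makes it constant under conjugation of \<open>g\<close>.\<close>

lemma tau_imp_separable_words:
  assumes ok: "relator_ok m0 n0"
    and e: "ea g = I k" "eb g = J k"
    and ne: "tau f mod q \<noteq> tau g mod q"
  shows "separable_words (comm_relator m0 n0) f g"
  unfolding separable_words_def
proof (intro exI[of _ coeff_equiv] conjI allI notI)
  fix h assume h: "coeff_equiv (f @ h) (h @ g)"
  note C = word_cong_coeff_equiv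
  have "coeff_equiv (f @ h @ inv_word h) (h @ g @ inv_word h)"
    using R_append[OF C h R_refl[OF C, of "inv_word h"]] by simp
  moreover have "coeff_equiv (f @ h @ inv_word h) f"
    using R_append[OF C R_refl[OF C, of f] R_inv_right[OF C, of h]] by simp
  ultimately have "coeff_equiv f (h @ g @ inv_word h)"
    using R_sym[OF C] R_trans[OF C] by blast
  then have "coeff_mod f = coeff_mod (h @ g @ inv_word h)"
    unfolding coeff_equiv_def by (metis append_Nil2)
  then have "tau f mod q = tau (h @ g @ inv_word h) mod q" by (rule tau_mod_cong)
  also have "tau (h @ g @ inv_word h) = tau ((g @ inv_word h) @ h)"
    by (rule tau_append_commute) (use e in auto)
  also have "word_eqv (comm_relator m0 n0) (g @ (inv_word h @ h)) (g @ [])"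
    by (intro R_append[OF word_cong_word_eqv] R_refl[OF word_cong_word_eqv] R_inv_left[OF word_cong_word_eqv])
  then have "tau ((g @ inv_word h) @ h) = tau g"
    using coeff_word_eqv[OF ok] by (simp add: tau_def)
  finally show False using ne by simp
qed (use word_cong_coeff_equiv word_eqv_le_coeff_equiv[OF ok] finite_range_word_class_coeff_equiv in auto)

end

end

text \<open>A failure of \<open>P\<close> would persist up to \<open>k\<close>, wrap around to 0 and
  reach \<open>u0\<close>.\<close>

lemma cyclic_invariant:
  fixes k :: nat
  assumes step: "\<And>u. u < k \<Longrightarrow> \<not> P u \<Longrightarrow> \<not> P (Suc u)" and cyc: "P k = P 0"
    and ex: "u0 < k" "P u0" and u: "u \<le> k"
  shows "P u"
proof (rule ccontr)
  have up: "\<not> P w" if "a \<le> w" "w \<le> k" "\<not> P a" for a w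
    using that by (induction w rule: dec_induct) (use step in auto)
  assume "\<not> P u"
  then have "\<not> P k" using up u by blast
  then show False using up[of 0 u0] cyc ex by auto
qed

section \<open>Item lists, their path weights and matches\<close>

context hop_machine
begin

text \<open>The exponent of the other generator then acts as a pure translation, so the whole item
  hops at most once. Its own exponent is unrestricted.\<close>

fun valid :: "item \<Rightarrow> bool" where
  "valid (t, a, b) = (if t then m dvd a else n dvd b)"

fun item_hop :: "item \<Rightarrow> int \<Rightarrow> int \<Rightarrow> nat \<Rightarrow> int" where
  "item_hop (t, a, b) i j v =
     (if t then gate True i j v - gate True i (j + b) v else gate False i j v - gate False (i + a) j v)"

lemma coeff_item:
  assumes "valid x"
  shows "coeff (item_word x @ w) d i j v = coeff w d (i + exp_a x) (j + exp_b x) v +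
     (if d = 0 then 0 else item_hop x i j v) * coeff w (d - 1) (i + exp_a x) (j + exp_b x) (Suc v)"
proof -
  obtain t a b where x: "x = (t, a, b)" by (metis prod.collapse)
  show ?thesis
  proof (cases t)
    case True
    then have "m dvd a" using assms x by simp
    then show ?thesis using True x by (simp add: coeff_pw[of True] coeff_pw_a Let_def)
  next
    case False
    then have "n dvd b" using assms x by simp
    then show ?thesis using False x by (simp add: coeff_pw[of False] coeff_pw_b Let_def)
  qed
qed

primrec path_weight :: "item list \<Rightarrow> int \<Rightarrow> int \<Rightarrow> nat \<Rightarrow> int" where
  "path_weight [] = (\<lambda>i j v. 1)"
| "path_weight (x # L) = (\<lambda>i j v. item_hop x i j v * path_weight L (i + exp_a x) (j + exp_b x) (Suc v))"

lemma coeff_list_above: "\<forall>x\<in>set L. valid x \<Longrightarrow> d > length L \<Longrightarrow> coeff (list_word L) d i j v = 0"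
  by (induction L arbitrary: d i j v) (auto simp: coeff_item)

lemma coeff_list_top: "\<forall>x\<in>set L. valid x \<Longrightarrow> coeff (list_word L) (length L) i j v = path_weight L i j v"
  by (induction L arbitrary: i j v) (auto simp: coeff_item coeff_list_above)

text \<open>A path with \<open>d\<close> hops from \<open>v\<close> must cross position
  \<open>u\<close>, whose gate is closed to items of type \<open>t\<close>.\<close>

lemma coeff_list_one_type:
  assumes "\<forall>x\<in>set L. valid x \<and> fst x = t" "ty u \<noteq> t" "v \<le> u" "u < v + d"
  shows "coeff (list_word L) d i j v = 0"
  using assms
proof (induction L arbitrary: d i j v)
  case (Cons x L)
  obtain a b where x: "x = (t, a, b)" using Cons.prems(1) by (cases x) auto
  have "item_hop x i j v * coeff (list_word L) (d - 1) (i + exp_a x) (j + exp_b x) (Suc v) = 0"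
  proof (cases "v = u")
    case True
    then show ?thesis using Cons.prems(2) x by (cases t) (auto simp: gate_def)
  next
    case False
    then have "coeff (list_word L) (d - 1) (i + exp_a x) (j + exp_b x) (Suc v) = 0"
      by (intro Cons.IH) (use Cons.prems in auto)
    then show ?thesis by simp
  qed
  moreover have "coeff (list_word L) d (i + exp_a x) (j + exp_b x) v = 0"
    by (rule Cons.IH) (use Cons.prems in auto)
  ultimately show ?case using Cons.prems(1) by (simp add: coeff_item)
qed simp

definition partial_a :: "item list \<Rightarrow> nat \<Rightarrow> int" where
  "partial_a L u = (\<Sum>w<u. exp_a (L ! w))"

definition partial_b :: "item list \<Rightarrow> nat \<Rightarrow> int" where
  "partial_b L u = (\<Sum>w<u. exp_b (L ! w))"

lemma path_weight_prod:
  "path_weight L i j v =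
     (\<Prod>u<length L. item_hop (L ! u) (i + partial_a L u) (j + partial_b L u) (v + u))"
proof (induction L arbitrary: i j v)
  case (Cons x L)
  have "partial_a (x # L) (Suc u) = exp_a x + partial_a L u"
       "partial_b (x # L) (Suc u) = exp_b x + partial_b L u" for u
    unfolding partial_a_def partial_b_def by (simp_all only: sum.lessThan_Suc_shift) simp_all
  moreover have "partial_a (x # L) 0 = 0" "partial_b (x # L) 0 = 0"
    by (simp_all add: partial_a_def partial_b_def)
  ultimately show ?case
    by (simp add: Cons.IH prod.lessThan_Suc_shift add.assoc del: prod.lessThan_Suc)
qed simp

text \<open>\<open>x\<close> and \<open>y\<close> are the differences between the coordinates along \<open>L\<close> and along the machine's own word,
  read from position \<open>v\<close>.\<close>

definition matches :: "item list \<Rightarrow> nat \<Rightarrow> (nat \<Rightarrow> int) \<Rightarrow> (nat \<Rightarrow> int) \<Rightarrow> bool" where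
  "matches L v x y \<longleftrightarrow> length L = k \<and> x k = x 0 \<and> y k = y 0 \<and>
     (\<forall>u<k. fst (L ! u) = ty (v + u)
        \<and> x (Suc u) = x u + exp_a (L ! u) - A (v + u)
        \<and> y (Suc u) = y u + exp_b (L ! u) - B (v + u)
        \<and> (if ty (v + u) then M dvd x u else N dvd y u)) \<and>
     (\<forall>u\<le>k. m dvd x u \<and> n dvd y u)"

lemma ty_mod: "ty (v mod k) = ty v"
proof -
  have "ty (w + c * k) = ty w" for w c
    by (induction c) (use ty_per in \<open>auto simp: add.assoc[symmetric] add.commute[of k]\<close>)
  from this[of "v mod k" "v div k"] show ?thesis by simp
qed

lemma ex_type_from: "\<exists>u<k. ty (v + u) = t"
proof -
  obtain w where w: "w < k" "ty w = t" using ex_type by blast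
  \<comment> \<open>The difference of \<open>w\<close> and \<open>v\<close> modulo \<open>k\<close>,
    written so that no subtraction of naturals truncates.\<close>
  let ?u = "(w + (k - v mod k)) mod k"
  have "(v + ?u) mod k = (v mod k + (w + (k - v mod k))) mod k" by (simp add: mod_simps)
  also have "\<dots> = (w + k) mod k"
    using mod_less_divisor[OF k_pos, of v] by (intro arg_cong[of _ _ "\<lambda>z. z mod k"]) linarith
  also have "\<dots> = w" using w by simp
  finally have "ty (v + ?u) = t" using w ty_mod by metis
  then show ?thesis using k_pos by (intro exI[of _ ?u]) auto
qed

text \<open>A nonzero hop comes with sign \<open>+\<close> or \<open>-\<close>, depending on whether its start or its end satisfies the gate. A
  minus sign in an \<open>a\<close>-step forces \<open>\<not> m dvd x\<close> afterwards, which then persists; but each \<open>b\<close>-step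
  requires \<open>M dvd x\<close>, and such a step occurs in every period. So all signs are plus.\<close>

lemma path_weight_matches:
  assumes len: "length L = k" and tot: "partial_a L k = I k" "partial_b L k = J k"
    and ne: "path_weight L i j v \<noteq> 0"
  shows "path_weight L i j v = 1 \<and> (\<exists>x y. matches L v x y)"
proof -
  define x where "x u = i + partial_a L u - I (v + u)" for u
  define y where "y u = j + partial_b L u - J (v + u)" for u
  have xS: "x (Suc u) = x u + exp_a (L ! u) - A (v + u)"
    and yS: "y (Suc u) = y u + exp_b (L ! u) - B (v + u)" for u
    by (simp_all add: x_def y_def partial_a_def partial_b_def)
  have cyc: "x k = x 0" "y k = y 0"
    using tot I_per[of v] J_per[of v] by (simp_all add: x_def y_def partial_a_def partial_b_def)
  have hop: "item_hop (L ! u) (i + partial_a L u) (j + partial_b L u) (v + u) \<noteq> 0" if "u < k" for u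
    using ne that len unfolding path_weight_prod by auto
  have types: "fst (L ! u) = ty (v + u)" if "u < k" for u
    using hop[OF that] by (cases "L ! u") (auto simp: gate_def split: if_splits)
  have ha: "N dvd y u \<and> (m dvd x u \<or> m dvd x u + exp_a (L ! u))" if "u < k" "\<not> ty (v + u)" for u
    using hop[OF that(1)] types[OF that(1)] that(2)
    by (cases "L ! u") (auto simp: gate_def x_def y_def algebra_simps split: if_splits)
  have hb: "M dvd x u \<and> (n dvd y u \<or> n dvd y u + exp_b (L ! u))" if "u < k" "ty (v + u)" for u
    using hop[OF that(1)] types[OF that(1)] that(2)
    by (cases "L ! u") (auto simp: gate_def x_def y_def algebra_simps split: if_splits)
  have dx: "m dvd x u" if "u \<le> k" for u
  proof -
    obtain u0 where u0: "u0 < k" "ty (v + u0)" using ex_type_from[of v True] by blast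
    show ?thesis
    proof (rule cyclic_invariant[of k "\<lambda>u. m dvd x u" u0])
      fix u assume u: "u < k" "\<not> m dvd x u"
      then have t: "\<not> ty (v + u)" using hb dvd_M dvd_trans by blast
      then have "m dvd x u + exp_a (L ! u)" using ha u by blast
      then show "\<not> m dvd x (Suc u)"
        unfolding xS using type_a[OF t] by (metis dvd_diff_right_iff)
    qed (use u0 hb dvd_M dvd_trans cyc that in auto)
  qed
  have dy: "n dvd y u" if "u \<le> k" for u
  proof -
    obtain u0 where u0: "u0 < k" "\<not> ty (v + u0)" using ex_type_from[of v False] by blast
    show ?thesis
    proof (rule cyclic_invariant[of k "\<lambda>u. n dvd y u" u0])
      fix u assume u: "u < k" "\<not> n dvd y u"
      then have t: "ty (v + u)" using ha dvd_N dvd_trans by blast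
      then have "n dvd y u + exp_b (L ! u)" using hb u by blast
      then show "\<not> n dvd y (Suc u)"
        unfolding yS using type_b[OF t] by (metis dvd_diff_right_iff)
    qed (use u0 ha dvd_N dvd_trans cyc that in auto)
  qed
  have "item_hop (L ! u) (i + partial_a L u) (j + partial_b L u) (v + u) = 1" if u: "u < k" for u
  proof (cases "ty (v + u)")
    case True
    \<comment> \<open>The gate at the end of the step is closed: otherwise \<open>n\<close> would
      divide \<open>B (v + u)\<close>, since it divides \<open>y (Suc u)\<close>. So only the
      positive term survives.\<close>
    have "\<not> n dvd y u + exp_b (L ! u)"
      using dy[of "Suc u"] u type_b[OF True] unfolding yS
      by (metis Suc_leI dvd_diff_right_iff)
    then show ?thesis using True hb[OF u True] dy[of u] u types[OF u]
      by (cases "L ! u") (auto simp: gate_def x_def y_def algebra_simps)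
  next
    case False
    have "\<not> m dvd x u + exp_a (L ! u)"
      using dx[of "Suc u"] u type_a[OF False] unfolding xS
      by (metis Suc_leI dvd_diff_right_iff)
    then show ?thesis using False ha[OF u False] dx[of u] u types[OF u]
      by (cases "L ! u") (auto simp: gate_def x_def y_def algebra_simps)
  qed
  then have "path_weight L i j v = 1"
    unfolding path_weight_prod len by simp
  moreover have "matches L v x y"
    unfolding matches_def using len cyc types xS yS ha hb dx dy by auto
  ultimately show ?thesis by blast
qed

definition own :: "item list" where
  "own = map (\<lambda>u. (ty u, A u, B u)) [0..<k]"

lemma own_simps: "length own = k" "u < k \<Longrightarrow> own ! u = (ty u, A u, B u)"
  by (auto simp: own_def)

lemma partial_own: "u \<le> k \<Longrightarrow> partial_a own u = I u" "u \<le> k \<Longrightarrow> partial_b own u = J u"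
  unfolding partial_a_def partial_b_def I_def J_def
  by (auto intro!: sum.cong simp: own_simps)

lemma valid_own: "\<forall>x\<in>set own. valid x"
  using type_a type_b by (auto simp: own_def)

text \<open>From the origin the word follows its own gates: each is open at the start of its
  syllable and closed at the end.\<close>

lemma path_weight_own: "path_weight own 0 0 0 = 1"
proof -
  have "item_hop (own ! u) (0 + partial_a own u) (0 + partial_b own u) (0 + u) = 1" if "u < k" for u
    using that type_a[of u] type_b[of u] by (auto simp: own_simps partial_own gate_def)
  then show ?thesis unfolding path_weight_prod own_simps by simp
qed

text \<open>\<open>tau\<close> vanishes on \<open>L\<close>, while on the machine's own word it lies
  between 1 and the number of states. The modulus \<open>q\<close>, one more than that number, keeps
  the two values apart.\<close>

lemma separable_words_own:
  assumes ok: "relator_ok m0 n0" and val: "\<forall>x\<in>set L. valid x"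
    and tot: "ea (list_word L) = I k" "eb (list_word L) = J k"
    and no: "length L < k \<or> (\<forall>x\<in>set L. fst x = t) \<or> length L = k \<and> (\<forall>v x y. \<not> matches L v x y)"
  shows "separable_words (comm_relator m0 n0) (list_word own) (list_word L)"
proof -
  let ?S = "{0..<M} \<times> {0..<N} \<times> {..<k}"
  define q where "q = int (card ?S) + 1"
  have total: "total F = (\<Sum>(i, j, v)\<in>?S. F i j v)" for F
    by (simp add: total_def sum.cartesian_product)
  have L: "coeff (list_word L) k i j v = 0" for i j v
    using no
  proof (elim disjE conjE)
    assume "length L < k" then show ?thesis using val by (rule coeff_list_above[rotated])
  next
    assume one: "\<forall>x\<in>set L. fst x = t"
    obtain u where "u < k" "ty (v + u) = (\<not> t)" using ex_type_from by blast
    then show ?thesis using val one by (intro coeff_list_one_type[of _ t "v + u"]) auto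
  next
    assume len: "length L = k" and nm: "\<forall>v x y. \<not> matches L v x y"
    have "partial_a L k = I k" "partial_b L k = J k"
      using tot by (simp_all add: ea_list_word eb_list_word partial_a_def partial_b_def len
          sum_list_sum_nth atLeast0LessThan)
    then show ?thesis
      using path_weight_matches[OF len] nm coeff_list_top[OF val] len by metis
  qed
  then have tL: "tau (list_word L) = 0" by (simp add: tau_def total_def)
  have own: "coeff (list_word own) k i j v = path_weight own i j v" for i j v
    using coeff_list_top[OF valid_own] by (simp add: own_simps)
  \<comment> \<open>Applied to the machine's own word, \<open>path_weight_matches\<close> excludes
    negative terms that could cancel the path from the origin.\<close>
  have val01: "path_weight own i j v \<in> {0, 1}" for i j v
    using path_weight_matches[of own i j v] by (auto simp: own_simps partial_own)
  have "1 \<le> tau (list_word own)"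
  proof -
    have "(\<lambda>(i, j, v). path_weight own i j v) (0, 0, 0) \<le> (\<Sum>(i, j, v)\<in>?S. path_weight own i j v)"
    proof (rule member_le_sum)
      fix s assume "s \<in> ?S - {(0, 0, 0)}"
      show "0 \<le> (case s of (i, j, v) \<Rightarrow> path_weight own i j v)"
        using val01 by (cases s) (metis (no_types, lifting) case_prod_conv insertE empty_iff order_refl zero_le_one)
    qed (use M_pos N_pos k_pos in auto)
    then show ?thesis by (simp add: tau_def total own path_weight_own)
  qed
  moreover have "tau (list_word own) \<le> int (card ?S) * 1"
    unfolding tau_def total own
  proof (rule sum_bounded_above)
    fix s show "(case s of (i, j, v) \<Rightarrow> path_weight own i j v) \<le> 1"
      using val01 by (cases s) (metis (no_types, lifting) case_prod_conv insertE empty_iff order_refl zero_le_one)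
  qed
  ultimately have "tau (list_word own) mod q \<noteq> tau (list_word L) mod q"
    unfolding tL q_def by (simp del: card_cartesian_product)
  then show ?thesis
    using tau_imp_separable_words[of q] ok tot by (simp add: q_def)
qed

end

subsection \<open>Reduction of words up to conjugacy\<close>

text \<open>\<open>matches\<close> for the machine driven by \<open>L\<close>, freed from the
  locale; positions are read modulo the length.\<close>

definition list_match ::
    "int \<Rightarrow> int \<Rightarrow> int \<Rightarrow> int \<Rightarrow> item list \<Rightarrow> item list \<Rightarrow> nat \<Rightarrow> (nat \<Rightarrow> int) \<Rightarrow> (nat \<Rightarrow> int) \<Rightarrow> bool" where
  "list_match m n M N L L' v x y \<longleftrightarrow> length L' = length L \<and> x (length L) = x 0 \<and> y (length L) = y 0 \<and>
     (\<forall>u<length L. let z = L ! ((v + u) mod length L) in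
          fst (L' ! u) = fst z
        \<and> x (Suc u) = x u + exp_a (L' ! u) - exp_a z
        \<and> y (Suc u) = y u + exp_b (L' ! u) - exp_b z
        \<and> (if fst z then M dvd x u else N dvd y u)) \<and>
     (\<forall>u\<le>length L. m dvd x u \<and> n dvd y u)"

text \<open>\<open>L\<close>, repeated periodically, drives a machine. A list of one type is always
  annihilated, whatever its length; otherwise only a match can prevent separation.\<close>

lemma separable_words_lists:
  fixes m n M N :: int
  assumes dvd: "m dvd M" "n dvd N" "M > 0" "N > 0"
    and rel: "M dvd int m0 \<or> N dvd int n0 \<or> (m dvd int m0 \<and> n dvd int n0)"
    and item_a: "\<And>x. x \<in> set L \<Longrightarrow> \<not> fst x \<Longrightarrow> \<not> m dvd exp_a x \<and> n dvd exp_b x"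
    and item_b: "\<And>x. x \<in> set L \<Longrightarrow> fst x \<Longrightarrow> \<not> n dvd exp_b x \<and> m dvd exp_a x"
    and adj: "\<And>u. u < length L \<Longrightarrow> fst (L ! u) = fst (L ! (Suc u mod length L)) \<Longrightarrow>
        (if fst (L ! u) then \<not> M dvd exp_a (L ! u) else \<not> N dvd exp_b (L ! u))"
    and both: "\<And>t. \<exists>x\<in>set L. fst x = t"
    and val: "\<And>x. x \<in> set L' \<Longrightarrow> (if fst x then m dvd exp_a x else n dvd exp_b x)"
    and tot: "ea (list_word L') = ea (list_word L)" "eb (list_word L') = eb (list_word L)"
    and len: "length L' \<le> length L \<or> (\<forall>x\<in>set L'. fst x = t)"
  shows "separable_words (comm_relator m0 n0) (list_word L) (list_word L') \<or>
    \<not> (\<forall>x\<in>set L'. fst x = t) \<and> (\<exists>v x y. list_match m n M N L L' v x y)"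
proof -
  define k where "k = length L"
  have k: "k > 0" using both[of True] by (auto simp: k_def)
  define ty where "ty v = fst (L ! (v mod k))" for v
  define A where "A v = exp_a (L ! (v mod k))" for v
  define B where "B v = exp_b (L ! (v mod k))" for v
  have mem: "L ! (v mod k) \<in> set L" for v using k by (simp add: k_def)
  have adj': "if ty v then \<not> M dvd A v else \<not> N dvd B v" if "ty v = ty (Suc v)" for v
    using adj[of "v mod k"] that k unfolding ty_def A_def B_def k_def
    by (auto simp: mod_Suc_eq split: if_splits)
  interpret hop_machine m n M N k ty A B
  proof
    show "\<exists>v<k. ty v = t" for t
    proof -
      obtain i where "i < k" "fst (L ! i) = t" using both[of t] by (metis in_set_conv_nth k_def)
      then show ?thesis by (intro exI[of _ i]) (simp add: ty_def)
    qed
    show "\<not> N dvd B v" if "\<not> ty v" "\<not> ty (Suc v)" for v using adj'[of v] that by simp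
    show "\<not> M dvd A v" if "ty v" "ty (Suc v)" for v using adj'[of v] that by simp
  qed (use dvd k item_a[OF mem] item_b[OF mem] in \<open>auto simp: ty_def A_def B_def\<close>)
  have own: "own = L"
  proof (rule nth_equalityI)
    show "length own = length L" using own_simps(1) k_def by metis
    fix i assume "i < length own"
    then have i: "i < k" using own_simps(1) by simp
    then have "own ! i = (ty i, A i, B i)" by (rule own_simps(2))
    also have "\<dots> = L ! i" using i by (simp add: ty_def A_def B_def)
    finally show "own ! i = L ! i" .
  qed
  have IJ: "I k = ea (list_word L)" "J k = eb (list_word L)"
    by (auto simp: ea_list_word eb_list_word I_def J_def A_def B_def sum_list_sum_nth k_def
        atLeast0LessThan intro!: sum.cong)
  have valid: "\<forall>x\<in>set L'. valid x"
    using val by fastforce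
  have ok: "relator_ok m0 n0" using rel by (simp add: relator_ok_def)
  show ?thesis
  proof (cases "\<not> (\<forall>x\<in>set L'. fst x = t) \<and> (\<exists>v x y. matches L' v x y)")
    case True
    then obtain v x y where "matches L' v x y" by blast
    then have "list_match m n M N L L' v x y"
      unfolding matches_def list_match_def by (auto simp: k_def ty_def A_def B_def Let_def)
    then show ?thesis using True by blast
  next
    case False
    have "length L' \<le> k \<or> (\<forall>x\<in>set L'. fst x = t)" using len unfolding k_def .
    then have no: "length L' < k \<or> (\<forall>x\<in>set L'. fst x = t) \<or> length L' = k \<and> (\<forall>v x y. \<not> matches L' v x y)"
      using False by auto
    have "separable_words (comm_relator m0 n0) (list_word own) (list_word L')"
      by (rule separable_words_own[OF ok valid _ _ no]) (simp_all add: tot IJ)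
    then show ?thesis by (simp add: own)
  qed
qed

lemma (in group) int_pow_commute:
  assumes "x \<otimes> y = y \<otimes> x" and [simp]: "x \<in> carrier G" "y \<in> carrier G"
  shows "x \<otimes> y [^] (i::int) = y [^] i \<otimes> x"
proof -
  have *: "x \<otimes> y [^] k = y [^] k \<otimes> x" for k :: nat
    using group_commutes_pow[of y x k] assms by simp
  show ?thesis
  proof (cases i)
    case (nonneg k)
    then show ?thesis using * by (simp add: int_pow_int)
  next
    case (neg k)
    have "x \<otimes> inv (y [^] Suc k) = inv (y [^] Suc k) \<otimes> x"
      using *[of "Suc k"] by (metis assms(2,3) inv_closed inv_solve_left inv_solve_right m_assoc m_closed nat_pow_closed)
    then show ?thesis using neg by (simp only: int_pow_neg_int assms)
  qed
qed

section \<open>Calculations with syllables in the presented group\<close>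

locale pres_mn =
  fixes m n :: nat
  assumes m_pos: "m > 0" and n_pos: "n > 0"
begin

abbreviation r where "r \<equiv> comm_relator m n"
abbreviation cl where "cl w \<equiv> word_class (word_eqv r) w"
definition G where "G = quotient_group (word_eqv r)"

sublocale group G
  unfolding G_def by (rule group_quotient_group[OF word_cong_word_eqv])

definition gen :: "bool \<Rightarrow> letter list set" where "gen g = cl [(g, True)]"

lemma cl_closed [simp]: "cl w \<in> carrier G"
  by (simp add: G_def carrier_quotient_group[OF word_cong_word_eqv])

lemma gen_closed [simp]: "gen g \<in> carrier G"
  by (simp add: gen_def)

lemma cl_append: "cl (u @ v) = cl u \<otimes>\<^bsub>G\<^esub> cl v"
  by (simp add: G_def mult_quotient_group[OF word_cong_word_eqv])

lemma cl_Nil: "cl [] = \<one>\<^bsub>G\<^esub>"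
  by (simp add: G_def one_quotient_group[OF word_cong_word_eqv])

lemma cl_eq_iff: "cl u = cl v \<longleftrightarrow> word_eqv r u v"
  by (rule word_class_eq_iff[OF word_cong_word_eqv])

lemma cl_inv_letter: "cl [(g, False)] = inv\<^bsub>G\<^esub> (gen g)"
proof -
  have "cl [(g, False)] \<otimes>\<^bsub>G\<^esub> gen g = \<one>\<^bsub>G\<^esub>"
    using word_eqv.cancel[of r "[]" "(g, False)" "[]"]
    unfolding gen_def cl_append[symmetric] cl_Nil[symmetric] cl_eq_iff by (simp add: flip_def)
  then show ?thesis using inv_equality by force
qed

lemma cl_replicate: "cl (replicate c x) = cl [x] [^]\<^bsub>G\<^esub> c"
proof (induction c)
  case (Suc c)
  have "cl (replicate (Suc c) x) = cl (replicate c x @ [x])"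
    by (simp add: replicate_append_same)
  then show ?case by (simp add: cl_append Suc)
qed (simp add: cl_Nil)

lemma cl_pw: "cl (pw g p) = gen g [^]\<^bsub>G\<^esub> p"
proof (cases "p \<ge> 0")
  case True
  then show ?thesis
    by (simp add: pw_def cl_replicate gen_def[symmetric])
next
  case False
  then have "pw g p = replicate (nat (- p)) (g, False)" by (simp add: pw_def)
  then have "cl (pw g p) = inv\<^bsub>G\<^esub> (gen g) [^]\<^bsub>G\<^esub> nat (- p)" by (simp add: cl_replicate cl_inv_letter)
  also have "\<dots> = inv\<^bsub>G\<^esub> (gen g [^]\<^bsub>G\<^esub> nat (- p))" by (simp add: nat_pow_inv)
  also have "\<dots> = gen g [^]\<^bsub>G\<^esub> (- int (nat (- p)))" by (rule int_pow_neg_int[symmetric]) simp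
  also have "- int (nat (- p)) = p" using False by simp
  finally show ?thesis .
qed

lemma commute_gen:
  assumes "int m dvd p" "int n dvd q"
  shows "gen False [^]\<^bsub>G\<^esub> p \<otimes>\<^bsub>G\<^esub> gen True [^]\<^bsub>G\<^esub> q = gen True [^]\<^bsub>G\<^esub> q \<otimes>\<^bsub>G\<^esub> gen False [^]\<^bsub>G\<^esub> p"
proof -
  let ?c = "gen False [^]\<^bsub>G\<^esub> int m" and ?d = "gen True [^]\<^bsub>G\<^esub> int n"
  have "cl (pw False (- int m) @ pw True (- int n) @ pw False (int m) @ pw True (int n)) = \<one>\<^bsub>G\<^esub>"
    unfolding cl_Nil[symmetric] cl_eq_iff using word_eqv.relator[of r "[]" "[]"]
    by (simp only: comm_relator_pw[symmetric] append_Nil append_Nil2)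
  then have "inv\<^bsub>G\<^esub> ?c \<otimes>\<^bsub>G\<^esub> (inv\<^bsub>G\<^esub> ?d \<otimes>\<^bsub>G\<^esub> (?c \<otimes>\<^bsub>G\<^esub> ?d)) = \<one>\<^bsub>G\<^esub>"
    by (simp add: cl_append cl_pw int_pow_neg)
  then have "?c \<otimes>\<^bsub>G\<^esub> ?d = ?d \<otimes>\<^bsub>G\<^esub> ?c"
    by (simp add: inv_solve_left')
  then have cd: "?c \<otimes>\<^bsub>G\<^esub> ?d [^]\<^bsub>G\<^esub> j = ?d [^]\<^bsub>G\<^esub> j \<otimes>\<^bsub>G\<^esub> ?c" for j :: int
    by (rule int_pow_commute) simp_all
  have "?d [^]\<^bsub>G\<^esub> j \<otimes>\<^bsub>G\<^esub> ?c [^]\<^bsub>G\<^esub> i = ?c [^]\<^bsub>G\<^esub> i \<otimes>\<^bsub>G\<^esub> ?d [^]\<^bsub>G\<^esub> j" for i j :: int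
    by (rule int_pow_commute) (simp_all add: cd)
  moreover obtain i j where "p = int m * i" "q = int n * j" using assms by (auto elim!: dvdE)
  ultimately show ?thesis by (simp add: int_pow_pow[symmetric])
qed

lemma commute_pw:
  assumes "int m dvd p" "int n dvd q"
  shows "cl (pw False p) \<otimes>\<^bsub>G\<^esub> cl (pw True q) = cl (pw True q) \<otimes>\<^bsub>G\<^esub> cl (pw False p)"
  by (simp add: cl_pw commute_gen[OF assms])

lemma pw_add: "cl (pw g p) \<otimes>\<^bsub>G\<^esub> cl (pw g q) = cl (pw g (p + q))"
  by (simp add: cl_pw int_pow_mult)

lemma pw_add_assoc: "cl (pw g p) \<otimes>\<^bsub>G\<^esub> (cl (pw g q) \<otimes>\<^bsub>G\<^esub> cl w) = cl (pw g (p + q)) \<otimes>\<^bsub>G\<^esub> cl w"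
  by (simp add: m_assoc[symmetric] pw_add)

lemma pw_0 [simp]: "pw g 0 = []" by (simp add: pw_def)

text \<open>The group is a tree of groups \<open><a>\<close> - \<open><a^m, b^n>\<close> -
  \<open><b>\<close> with edge groups \<open><a^m>\<close> and \<open><b^n>\<close>. A good item is
  an element of an outer vertex group outside its edge group, followed by an element of the middle
  one.\<close>

definition good :: "item \<Rightarrow> bool" where
  "good x \<longleftrightarrow> (if fst x then \<not> int n dvd exp_b x \<and> int m dvd exp_a x
                       else \<not> int m dvd exp_a x \<and> int n dvd exp_b x)"

text \<open>The exponents involved that belong to different generators are multiples of
  \<open>m\<close> and \<open>n\<close>, so these powers commute and equal generators can be
  collected.\<close>

lemma item_absorb:
  assumes "good (t, A, B)" "int m dvd X" "int n dvd Y"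
  shows "cl (item_word (t, A, B) @ pw False X @ pw True Y) = cl (item_word (t, A + X, B + Y))"
proof (cases t)
  case False
  then have "int n dvd B" using assms by (simp add: good_def)
  then have "cl (pw True B) \<otimes>\<^bsub>G\<^esub> (cl (pw False X) \<otimes>\<^bsub>G\<^esub> cl (pw True Y)) =
      cl (pw False X) \<otimes>\<^bsub>G\<^esub> cl (pw True (B + Y))"
    by (simp add: m_assoc[symmetric] commute_pw[OF assms(2)]) (simp add: m_assoc pw_add commute_pw[OF assms(2), symmetric])
  then show ?thesis using False by (simp add: cl_append m_assoc pw_add_assoc)
next
  case True
  then have "int m dvd A + X" using assms by (simp add: good_def)
  then have "cl (pw False A) \<otimes>\<^bsub>G\<^esub> (cl (pw False X) \<otimes>\<^bsub>G\<^esub> cl (pw True Y)) =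
      cl (pw True Y) \<otimes>\<^bsub>G\<^esub> cl (pw False (A + X))"
    using commute_pw[OF \<open>int m dvd A + X\<close> assms(3)] by (simp add: pw_add_assoc)
  then show ?thesis using True by (simp add: cl_append m_assoc pw_add_assoc)
qed

lemma conj_words_iff: "conj_words r u v \<longleftrightarrow> (\<exists>h. cl u \<otimes>\<^bsub>G\<^esub> cl h = cl h \<otimes>\<^bsub>G\<^esub> cl v)"
  by (simp add: conj_words_def cl_eq_iff[symmetric] cl_append)

lemma conj_words_eq: "cl u = cl v \<Longrightarrow> conj_words r u v"
  unfolding conj_words_iff by (rule exI[of _ "[]"]) (simp add: cl_Nil)

lemma conj_words_trans: "conj_words r u v \<Longrightarrow> conj_words r v w \<Longrightarrow> conj_words r u w"
proof -
  assume "conj_words r u v" "conj_words r v w"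
  then obtain h k where h: "cl u \<otimes>\<^bsub>G\<^esub> cl h = cl h \<otimes>\<^bsub>G\<^esub> cl v" and k: "cl v \<otimes>\<^bsub>G\<^esub> cl k = cl k \<otimes>\<^bsub>G\<^esub> cl w"
    by (auto simp: conj_words_iff)
  have "cl u \<otimes>\<^bsub>G\<^esub> (cl h \<otimes>\<^bsub>G\<^esub> cl k) = cl h \<otimes>\<^bsub>G\<^esub> (cl v \<otimes>\<^bsub>G\<^esub> cl k)"
    by (simp add: m_assoc[symmetric] h)
  also have "\<dots> = (cl h \<otimes>\<^bsub>G\<^esub> cl k) \<otimes>\<^bsub>G\<^esub> cl w" by (simp add: m_assoc k)
  finally show ?thesis unfolding conj_words_iff cl_append[symmetric] by blast
qed

lemma conj_words_sym: "conj_words r u v \<Longrightarrow> conj_words r v u"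
proof -
  assume "conj_words r u v"
  then obtain h where h: "cl u \<otimes>\<^bsub>G\<^esub> cl h = cl h \<otimes>\<^bsub>G\<^esub> cl v" by (auto simp: conj_words_iff)
  have i: "cl (inv_word h) \<otimes>\<^bsub>G\<^esub> cl h = \<one>\<^bsub>G\<^esub>" "cl h \<otimes>\<^bsub>G\<^esub> cl (inv_word h) = \<one>\<^bsub>G\<^esub>"
    unfolding cl_append[symmetric] cl_Nil[symmetric] cl_eq_iff
    by (rule R_inv_left[OF word_cong_word_eqv] R_inv_right[OF word_cong_word_eqv])+
  have "cl v \<otimes>\<^bsub>G\<^esub> cl (inv_word h) = cl (inv_word h) \<otimes>\<^bsub>G\<^esub> (cl h \<otimes>\<^bsub>G\<^esub> cl v) \<otimes>\<^bsub>G\<^esub> cl (inv_word h)"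
    by (simp add: m_assoc[symmetric] i)
  also have "\<dots> = cl (inv_word h) \<otimes>\<^bsub>G\<^esub> cl u"
    unfolding h[symmetric] by (simp add: m_assoc i)
  finally show ?thesis unfolding conj_words_iff by blast
qed

lemma conj_words_rotate: "conj_words r (u @ v) (v @ u)"
  unfolding conj_words_iff by (rule exI[of _ u]) (simp add: cl_append m_assoc)

lemma conj_words_rotate_list: "conj_words r (list_word L) (list_word (rotate u L))"
  by (metis conj_words_rotate append_take_drop_id list_word_simps(3) rotate_drop_take)

text \<open>Conjugation moves the prefix to the end, where the last item absorbs it and stays
  good.\<close>

lemma absorb_list:
  assumes "\<forall>x\<in>set L. good x" "L \<noteq> []" "int m dvd X" "int n dvd Y"
  shows "\<exists>L'. length L' = length L \<and> (\<forall>x\<in>set L'. good x) \<and>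
     conj_words r (pw False X @ pw True Y @ list_word L) (list_word L')"
proof -
  obtain L0 t A B where L: "L = L0 @ [(t, A, B)]"
    using assms(2) by (metis append_butlast_last_id prod.collapse)
  let ?L' = "L0 @ [(t, A + X, B + Y)]"
  have g: "good (t, A, B)" using assms L by simp
  have "conj_words r (pw False X @ pw True Y @ list_word L) (list_word L @ pw False X @ pw True Y)"
    using conj_words_rotate[of "pw False X @ pw True Y" "list_word L"] by simp
  moreover have "cl (list_word L @ pw False X @ pw True Y) = cl (list_word ?L')"
    using item_absorb[OF g assms(3,4)] by (simp add: L cl_append m_assoc del: item_word.simps)
  ultimately have "conj_words r (pw False X @ pw True Y @ list_word L) (list_word ?L')"
    using conj_words_eq conj_words_trans by blast
  moreover have "good (t, A + X, B + Y)"
    using g assms(3,4) by (auto simp: good_def dvd_add_left_iff split: if_splits)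
  ultimately show ?thesis using assms L by (intro exI[of _ ?L']) auto
qed

text \<open>Letters are added on the left to a prefix in \<open><a^m, b^n>\<close>. When a letter
  pushes an exponent off the multiples of \<open>m\<close> or \<open>n\<close>, the whole prefix
  becomes a new item and the prefix restarts as trivial.\<close>

lemma word_decomposition:
  "\<exists>X Y L. int m dvd X \<and> int n dvd Y \<and> (\<forall>x\<in>set L. good x) \<and>
     cl w = cl (pw False X @ pw True Y @ list_word L)"
proof (induction w)
  case Nil
  show ?case by (intro exI[of _ 0] exI[of _ "[]"]) simp
next
  case (Cons x w)
  then obtain X Y L where IH: "int m dvd X" "int n dvd Y" "\<forall>x\<in>set L. good x"
    "cl w = cl (pw False X @ pw True Y @ list_word L)" by blast
  obtain g e where x: "x = (g, e)" by force
  define s :: int where "s = (if e then 1 else - 1)"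
  have "[x] = pw g s" by (simp add: x s_def pw_def)
  moreover have "cl (x # w) = cl [x] \<otimes>\<^bsub>G\<^esub> cl w"
    using cl_append[of "[x]" w] by simp
  ultimately have w: "cl (x # w) = cl (pw g s) \<otimes>\<^bsub>G\<^esub> (cl (pw False X) \<otimes>\<^bsub>G\<^esub> (cl (pw True Y) \<otimes>\<^bsub>G\<^esub> cl (list_word L)))"
    by (simp only: IH(4) cl_append)
  show ?case
  proof (cases g)
    case False
    then have w': "cl (x # w) = cl (pw False (s + X) @ pw True Y @ list_word L)"
      using w pw_add_assoc[of False s X "pw True Y @ list_word L"] by (simp add: cl_append m_assoc)
    show ?thesis
    proof (cases "int m dvd s + X")
      case True
      then show ?thesis using IH w' by blast
    next
      case False
      then have "cl (x # w) = cl (pw False 0 @ pw True 0 @ list_word ((False, s + X, Y) # L))"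
        using w' by simp
      moreover have "\<forall>x\<in>set ((False, s + X, Y) # L). good x" using IH False by (simp add: good_def)
      ultimately show ?thesis by (meson dvd_0_right)
    qed
  next
    case True
    have "cl (x # w) = cl (pw True s) \<otimes>\<^bsub>G\<^esub> ((cl (pw False X) \<otimes>\<^bsub>G\<^esub> cl (pw True Y)) \<otimes>\<^bsub>G\<^esub> cl (list_word L))"
      using w True by (simp add: m_assoc)
    also have "\<dots> = cl (pw True (s + Y)) \<otimes>\<^bsub>G\<^esub> (cl (pw False X) \<otimes>\<^bsub>G\<^esub> cl (list_word L))"
      unfolding commute_pw[OF IH(1,2)] using pw_add_assoc[of True s Y "pw False X @ list_word L"]
      by (simp add: cl_append m_assoc)
    finally have w': "cl (x # w) = cl (pw True (s + Y)) \<otimes>\<^bsub>G\<^esub> (cl (pw False X) \<otimes>\<^bsub>G\<^esub> cl (list_word L))" .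
    show ?thesis
    proof (cases "int n dvd s + Y")
      case True
      have "cl (x # w) = cl (pw False X @ pw True (s + Y) @ list_word L)"
        using w' commute_pw[OF IH(1) True] by (simp add: cl_append m_assoc[symmetric])
      then show ?thesis using IH True by blast
    next
      case False
      then have "cl (x # w) = cl (pw False 0 @ pw True 0 @ list_word ((True, X, s + Y) # L))"
        using w' by (simp add: cl_append m_assoc)
      moreover have "\<forall>x\<in>set ((True, X, s + Y) # L). good x" using IH False by (simp add: good_def)
      ultimately show ?thesis by (meson dvd_0_right)
    qed
  qed
qed

text \<open>Normal forms of the elements of the three vertex groups.\<close>

definition elliptic :: "letter list \<Rightarrow> bool" where
  "elliptic w \<longleftrightarrow> (\<exists>p q. w = pw False p @ pw True q \<and> (p = 0 \<or> q = 0 \<or> int m dvd p \<and> int n dvd q))"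

text \<open>Cyclic reducedness: between neighbours of the same type the middle element must lie
  outside their common edge group, since otherwise they would merge.\<close>

definition reduced :: "item list \<Rightarrow> bool" where
  "reduced L \<longleftrightarrow> L \<noteq> [] \<and> (\<forall>x\<in>set L. good x) \<and>
     (\<forall>u<length L. fst (L ! u) = fst (L ! (Suc u mod length L)) \<longrightarrow>
        (if fst (L ! u) then exp_a (L ! u) \<noteq> 0 else exp_b (L ! u) \<noteq> 0))"

lemma merge_items:
  assumes "good (t, A0, B0)" "good (t, A1, B1)" "if t then A0 = 0 else B0 = 0"
  shows "cl (item_word (t, A0, B0) @ item_word (t, A1, B1)) = cl (item_word (t, A0 + A1, B0 + B1))"
  using assms by (cases t) (simp_all add: cl_append pw_add_assoc)

text \<open>A violation is rotated to the front and its two items merged. The result is either one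
  good item or an element of \<open><a^m, b^n>\<close>, which the rest absorbs; both shorten the
  list.\<close>

lemma good_list_reduces:
  assumes "\<forall>x\<in>set L. good x" "L \<noteq> []"
  shows "\<exists>w. conj_words r (list_word L) w \<and> (elliptic w \<or> (\<exists>L'. reduced L' \<and> w = list_word L'))"
  using assms
proof (induction "length L" arbitrary: L rule: less_induct)
  case less
  show ?case
  proof (cases "reduced L")
    case True
    then show ?thesis using conj_words_eq by blast
  next
    case False
    then obtain u where u: "u < length L" "fst (L ! u) = fst (L ! (Suc u mod length L))"
      "if fst (L ! u) then exp_a (L ! u) = 0 else exp_b (L ! u) = 0"
      using less.prems unfolding reduced_def by auto
    have rot: "conj_words r (list_word L) (list_word (rotate u L))" by (rule conj_words_rotate_list)
    obtain x0 rest where L2: "rotate u L = x0 # rest"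
      using less.prems(2) by (metis neq_Nil_conv rotate_is_Nil_conv)
    have len: "length L = Suc (length rest)" using L2 by (metis length_rotate length_Cons)
    have x0: "x0 = L ! u" using nth_rotate[of 0 L u] u L2 less.prems(2) by simp
    obtain t A0 B0 where x0': "x0 = (t, A0, B0)" by (metis prod.collapse)
    have g2: "\<forall>x\<in>set (rotate u L). good x" using less.prems by simp
    have z: "if t then A0 = 0 else B0 = 0" using u x0 x0' by (metis fst_conv snd_conv)
    show ?thesis
    proof (cases rest)
      case Nil
      \<comment> \<open>A single item is its own cyclic neighbour, so the violation makes it a power
        of one generator.\<close>
      then have "list_word (rotate u L) = pw False A0 @ pw True B0" "A0 = 0 \<or> B0 = 0"
        using L2 x0' z by (cases t; simp)+
      then have "elliptic (list_word (rotate u L))"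
        unfolding elliptic_def by blast
      then show ?thesis using rot by blast
    next
      case (Cons x1 rest')
      then have "x1 = L ! (Suc u mod length L)"
        using nth_rotate[of 1 L u] L2 len by simp
      then have "fst x1 = t" using u(2) x0 x0' by (metis fst_conv)
      then obtain A1 B1 where x1: "x1 = (t, A1, B1)" by (cases x1) auto
      have g: "good (t, A0, B0)" "good (t, A1, B1)" and gr: "\<forall>x\<in>set rest'. good x"
        using g2 L2 Cons x0' x1 by auto
      let ?A = "A0 + A1" and ?B = "B0 + B1"
      have eq: "cl (list_word (rotate u L)) = cl (item_word (t, ?A, ?B) @ list_word rest')"
        using merge_items[OF g z] L2 Cons x0' x1
        by (simp add: cl_append m_assoc[symmetric] del: item_word.simps)
      show ?thesis
      proof (cases "good (t, ?A, ?B)")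
        case True
        let ?L' = "(t, ?A, ?B) # rest'"
        have "\<exists>w. conj_words r (list_word ?L') w \<and> (elliptic w \<or> (\<exists>L'. reduced L' \<and> w = list_word L'))"
          by (rule less.hyps) (use len Cons True gr in auto)
        moreover have "conj_words r (list_word L) (list_word ?L')"
          using conj_words_trans[OF rot] conj_words_eq[OF eq] by simp
        ultimately show ?thesis using conj_words_trans by blast
      next
        case False
        then have d: "int m dvd ?A" "int n dvd ?B"
          using g z by (auto simp: good_def split: if_splits)
        then have "cl (item_word (t, ?A, ?B)) = cl (pw False ?A @ pw True ?B)"
          using commute_pw by (cases t) (auto simp: cl_append)
        then have c: "conj_words r (list_word L) (pw False ?A @ pw True ?B @ list_word rest')"
          using conj_words_trans[OF rot conj_words_eq] eq by (simp add: cl_append m_assoc del: item_word.simps)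
        show ?thesis
        proof (cases "rest' = []")
          case True
          then show ?thesis using c d unfolding elliptic_def by auto
        next
          case False
          obtain L' where L': "length L' = length rest'" "\<forall>x\<in>set L'. good x"
            "conj_words r (pw False ?A @ pw True ?B @ list_word rest') (list_word L')"
            using absorb_list[OF gr False d] by blast
          have "\<exists>w. conj_words r (list_word L') w \<and> (elliptic w \<or> (\<exists>L'. reduced L' \<and> w = list_word L'))"
            by (rule less.hyps) (use len Cons L' False in auto)
          then show ?thesis using conj_words_trans[OF c] conj_words_trans L'(3) by blast
        qed
      qed
    qed
  qed
qed

lemma word_reduces:
  "\<exists>w'. conj_words r w w' \<and> (elliptic w' \<or> (\<exists>L. reduced L \<and> w' = list_word L))"
proof -
  obtain X Y L where d: "int m dvd X" "int n dvd Y" "\<forall>x\<in>set L. good x"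
     "cl w = cl (pw False X @ pw True Y @ list_word L)"
    using word_decomposition[of w] by (elim exE conjE) (rule that)
  show ?thesis
  proof (cases "L = []")
    case True
    then have "conj_words r w (pw False X @ pw True Y)" using d(4) by (intro conj_words_eq) simp
    moreover have "elliptic (pw False X @ pw True Y)" using d unfolding elliptic_def by blast
    ultimately show ?thesis by blast
  next
    case False
    obtain L' where L': "length L' = length L" "\<forall>x\<in>set L'. good x"
      "conj_words r (pw False X @ pw True Y @ list_word L) (list_word L')"
      using absorb_list[OF d(3) False d(1,2)] by blast
    have "L' \<noteq> []" using False L'(1) by auto
    obtain w' where w': "conj_words r (list_word L') w'" "elliptic w' \<or> (\<exists>L. reduced L \<and> w' = list_word L)"
      using good_list_reduces[OF L'(2) \<open>L' \<noteq> []\<close>] by (elim exE conjE) (rule that)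
    have "conj_words r w w'"
      by (rule conj_words_trans[OF conj_words_trans[OF conj_words_eq[OF d(4)] L'(3)] w'(1)])
    then show ?thesis using w'(2) by (intro exI[of _ w'] conjI)
  qed
qed

text \<open>Syllable by syllable, \<open>L'\<close> arises from \<open>R\<close> by conjugating with elements \<open>a\<^bsup>x u\<^esup> b\<^bsup>y u\<^esup>\<close> of the
  amalgamated subgroup, each commuting with the adjacent syllable.\<close>

lemma telescope:
  assumes "length L' = length R" "\<forall>x\<in>set R. good x" "\<forall>x\<in>set L'. good x"
    and "\<forall>u<length R. fst (L' ! u) = fst (R ! u)
        \<and> x (Suc u) = x u + exp_a (L' ! u) - exp_a (R ! u)
        \<and> y (Suc u) = y u + exp_b (L' ! u) - exp_b (R ! u)
        \<and> (if fst (R ! u) then x u = 0 else y u = 0)"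
    and "\<forall>u\<le>length R. int m dvd x u \<and> int n dvd y u"
  shows "cl (pw False (x 0) @ pw True (y 0) @ list_word L') =
         cl (list_word R @ pw False (x (length R)) @ pw True (y (length R)))"
  using assms
proof (induction L' R arbitrary: x y rule: list_induct2)
  case (Cons z' L' z R)
  obtain t A B where z: "z = (t, A, B)" by (metis prod.collapse)
  obtain A' B' where z': "z' = (t, A', B')" using Cons.prems(3) z by (cases z') force
  have s: "x 1 = x 0 + A' - A" "y 1 = y 0 + B' - B" "if t then x 0 = 0 else y 0 = 0"
    using spec[OF Cons.prems(3), of 0] by (auto simp: z z')
  have d: "int m dvd x 0" "int n dvd y 0" "int m dvd x 1" "int n dvd y 1"
    using Cons.prems(4) by auto
  have IH: "cl (pw False (x 1) @ pw True (y 1) @ list_word L') =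
         cl (list_word R @ pw False (x (Suc (length R))) @ pw True (y (Suc (length R))))"
  proof -
    have "\<forall>u<length R. fst (L' ! u) = fst (R ! u)
        \<and> x (Suc (Suc u)) = x (Suc u) + exp_a (L' ! u) - exp_a (R ! u)
        \<and> y (Suc (Suc u)) = y (Suc u) + exp_b (L' ! u) - exp_b (R ! u)
        \<and> (if fst (R ! u) then x (Suc u) = 0 else y (Suc u) = 0)"
    proof (intro allI impI)
      fix u assume "u < length R"
      then show "fst (L' ! u) = fst (R ! u)
        \<and> x (Suc (Suc u)) = x (Suc u) + exp_a (L' ! u) - exp_a (R ! u)
        \<and> y (Suc (Suc u)) = y (Suc u) + exp_b (L' ! u) - exp_b (R ! u)
        \<and> (if fst (R ! u) then x (Suc u) = 0 else y (Suc u) = 0)"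
        using Cons.prems(3)[rule_format, of "Suc u"] by simp
    qed
    then show ?thesis
      unfolding One_nat_def
      by (intro Cons.IH[of "\<lambda>u. x (Suc u)" "\<lambda>u. y (Suc u)"]) (use Cons.prems(1,2,4) in auto)
  qed
  \<comment> \<open>The coordinate of the other generator vanishes, so the prefix is a power of the
    syllable's own generator and merges with it.\<close>
  have "cl (pw False (x 0) @ pw True (y 0) @ item_word z') = cl (item_word (t, A + x 1, B + y 1))"
    using s by (cases t) (simp_all add: z' cl_append pw_add pw_add_assoc)
  also have "\<dots> = cl (item_word z @ pw False (x 1) @ pw True (y 1))"
    unfolding z by (rule item_absorb[symmetric]) (use Cons.prems z d in auto)
  finally have "cl (pw False (x 0) @ pw True (y 0) @ item_word z' @ list_word L')
     = cl (item_word z @ pw False (x 1) @ pw True (y 1) @ list_word L')"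
    by (simp add: cl_append m_assoc[symmetric] del: item_word.simps)
  also have "\<dots> = cl (item_word z @ list_word R @ pw False (x (Suc (length R))) @ pw True (y (Suc (length R))))"
    using IH by (simp add: cl_append del: item_word.simps)
  finally show ?case by simp
qed simp

end

subsection \<open>Separating non-conjugate words\<close>

text \<open>Reduction of \<open>e\<close> modulo \<open>q\<close> is a homomorphism to a finite
  cyclic group, where conjugate elements have equal images; \<open>q\<close> exceeds the difference
  of the two values.\<close>

lemma separable_words_additive:
  fixes e :: "letter list \<Rightarrow> int"
  assumes add: "\<And>u v. e (u @ v) = e u + e v" and flip: "\<And>x. e [x, flip x] = 0" and rel: "e r = 0"
    and ne: "e f \<noteq> e g"
  shows "separable_words r f g"
proof -
  define q where "q = \<bar>e f - e g\<bar> + 1"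
  define R where "R u v \<longleftrightarrow> e u mod q = e v mod q" for u v
  have q: "q > 0" by (simp add: q_def)
  have e0: "e [] = 0" using add[of "[]" "[]"] by simp
  have "word_cong R"
    unfolding word_cong_def
  proof (intro conjI allI impI)
    show "equivp R" by (rule equivpI) (auto simp: R_def reflp_def symp_def transp_def)
    show "R (u @ v) (u' @ v')" if "R u u'" "R v v'" for u u' v v'
      using that unfolding R_def add by (rule mod_add_cong)
    show "R [x, flip x] []" for x by (simp add: R_def flip e0)
  qed
  moreover have "word_eqv r \<le> R"
  proof (intro predicate2I)
    fix u v assume "word_eqv r u v"
    then have "e u = e v"
    proof (induction rule: word_eqv.induct)
      case (cancel u x v)
      then show ?case using flip[of x] add[of "[x, flip x]" v] by (simp only: add)
    qed (simp_all add: add rel)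
    then show "R u v" by (simp add: R_def)
  qed
  moreover have "finite (range (word_class R))"
  proof (rule finite_surj[of "{0..<q}"])
    show "range (word_class R) \<subseteq> (\<lambda>c. {v. c = e v mod q}) ` {0..<q}"
      using q by (auto simp: word_class_def R_def)
  qed simp
  moreover have "\<not> R (f @ h) (h @ g)" for h
  proof
    assume "R (f @ h) (h @ g)"
    then have "q dvd (e f + e h) - (e h + e g)" by (simp add: R_def add mod_eq_dvd_iff)
    then have "q dvd e f - e g" by simp
    then have "\<bar>q\<bar> \<le> \<bar>e f - e g\<bar>" using ne by (intro dvd_imp_le_int) auto
    then show False by (simp add: q_def)
  qed
  ultimately show ?thesis unfolding separable_words_def by blast
qed

text \<open>Bounds how far the differences \<open>x\<close> and \<open>y\<close> of a match can
  drift, so that divisibility by a larger number becomes equality.\<close>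

definition weight :: "item list \<Rightarrow> int" where
  "weight L = sum_list (map (\<lambda>x. \<bar>exp_a x\<bar> + \<bar>exp_b x\<bar>) L)"

lemma weight_nonneg: "0 \<le> weight L"
  unfolding weight_def by (rule sum_list_nonneg) auto

lemma weight_mem: "x \<in> set L \<Longrightarrow> \<bar>exp_a x\<bar> + \<bar>exp_b x\<bar> \<le> weight L"
proof (induction L)
  case (Cons z L)
  then show ?case using weight_nonneg[of L] by (fastforce simp: weight_def)
qed simp

lemma weight_rotate: "weight (rotate v L) = weight L"
proof -
  have app: "weight (K @ L) = weight K + weight L" for K L by (simp add: weight_def)
  let ?v = "v mod length L"
  have "weight (rotate v L) = weight (take ?v L) + weight (drop ?v L)"
    by (simp add: rotate_drop_take app)
  then show ?thesis by (simp add: app[symmetric])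
qed

lemma partial_sum_bound:
  fixes x :: "nat \<Rightarrow> int"
  assumes "\<And>i. i < k \<Longrightarrow> \<bar>x (Suc i) - x i\<bar> \<le> c i" and c: "\<And>i. i < k \<Longrightarrow> 0 \<le> c i"
    and "u \<le> w" "w \<le> k"
  shows "\<bar>x w - x u\<bar> \<le> (\<Sum>i<k. c i)"
proof -
  have "\<bar>x w - x u\<bar> \<le> (\<Sum>i\<in>{u..<w}. c i)"
    using assms(3,4)
  proof (induction w rule: dec_induct)
    case (step w)
    then show ?case using assms(1)[of w] by (simp add: sum.atLeastLessThan_Suc)
  qed simp
  also have "\<dots> \<le> (\<Sum>i<k. c i)"
    by (rule sum_mono2) (use assms(4) c in auto)
  finally show ?thesis .
qed

lemma small_multiple_zero:
  fixes z d T :: int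
  assumes "d * T dvd z" "\<bar>z\<bar> < T" "d > 0"
  shows "z = 0"
proof (rule ccontr)
  assume "z \<noteq> 0"
  then have "\<bar>d * T\<bar> \<le> \<bar>z\<bar>" using assms(1) by (intro dvd_imp_le_int) auto
  moreover have "1 * T \<le> d * T" using assms by (intro mult_right_mono) auto
  ultimately show False using assms(2) by linarith
qed

text \<open>If only \<open>a\<close>-syllables occur, the machine has no \<open>b\<close>-steps to control the signs. Then we kill
  \<open>a\<^sup>m\<close> (take \<open>M = m\<close>) and treat the powers of \<open>b\<^sup>n\<close> between the syllables as syllables themselves, which is
  legitimate because the relator holds for trivial reasons.\<close>

definition part :: "bool \<Rightarrow> item \<Rightarrow> item" where
  "part s x = (if s then (True, 0, exp_b x) else (False, exp_a x, 0))"

definition double :: "bool \<Rightarrow> item list \<Rightarrow> item list" where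
  "double t L = concat (map (\<lambda>x. [part t x, part (\<not> t) x]) L)"

lemma double_simps [simp]:
  "double t [] = []" "double t (x # L) = part t x # part (\<not> t) x # double t L"
  by (simp_all add: double_def)

lemma length_double [simp]: "length (double t L) = 2 * length L"
  by (induction L) auto

lemma part_simps [simp]:
  "fst (part s x) = s" "exp_a (part s x) = (if s then 0 else exp_a x)"
  "exp_b (part s x) = (if s then exp_b x else 0)"
  by (auto simp: part_def)

lemma nth_double:
  "u < length L \<Longrightarrow> double t L ! (2 * u) = part t (L ! u) \<and> double t L ! Suc (2 * u) = part (\<not> t) (L ! u)"
proof (induction L arbitrary: u)
  case (Cons x L)
  then show ?case by (cases u) auto
qed simp

lemma nth_double_type: "i < 2 * length L \<Longrightarrow> fst (double t L ! i) = (if even i then t else \<not> t)"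
proof -
  assume i: "i < 2 * length L"
  have "i = 2 * (i div 2) \<or> i = Suc (2 * (i div 2))" by presburger
  moreover have "i div 2 < length L" using i by auto
  ultimately show ?thesis using nth_double[of "i div 2" L t] part_simps(1)
    by (metis even_Suc even_mult_iff even_numeral)
qed

lemma double_cases:
  assumes "x \<in> set (double t L)"
  obtains z s where "z \<in> set L" "x = part s z"
  using assms by (induction L) auto

lemma Suc_double_mod: "Suc (2 * a) mod (2 * k) = Suc (2 * (a mod k))" for a k :: nat
  by (simp add: mod_mult2_eq)

section \<open>From matches to conjugacy, and separation of reduced lists\<close>

context pres_mn
begin

text \<open>Since \<open>T\<close> exceeds the total drift, \<open>x\<close> has one value
  \<open>sx\<close> at all \<open>b\<close>-items and \<open>y\<close> one value \<open>sy\<close>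
  at all \<open>a\<close>-items. Subtracting these constants makes \<open>telescope\<close>
  applicable to a rotation of \<open>L\<close>.\<close>

lemma match_imp_conj_words:
  assumes len: "length L' = length L" and good: "\<forall>x\<in>set L. good x" "\<forall>x\<in>set L'. good x"
    and cyc: "x (length L) = x 0" "y (length L) = y 0"
    and step: "\<And>u. u < length L \<Longrightarrow> let z = L ! ((v + u) mod length L) in fst (L' ! u) = fst z
        \<and> x (Suc u) = x u + exp_a (L' ! u) - exp_a z
        \<and> y (Suc u) = y u + exp_b (L' ! u) - exp_b z
        \<and> (if fst z then int m * T dvd x u else int n * T dvd y u)"
    and div: "\<And>u. u \<le> length L \<Longrightarrow> int m dvd x u \<and> int n dvd y u"
    and bnd: "weight L + weight L' < T"
  shows "conj_words r (list_word L) (list_word L')"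
proof -
  define k where "k = length L"
  define R where "R = rotate v L"
  have R: "R ! u = L ! ((v + u) mod k)" if "u < k" for u
    using that by (simp add: R_def k_def nth_rotate)
  have lR: "length R = k" by (simp add: R_def k_def)
  define c where "c i = (\<bar>exp_a (L' ! i)\<bar> + \<bar>exp_b (L' ! i)\<bar>) + (\<bar>exp_a (R ! i)\<bar> + \<bar>exp_b (R ! i)\<bar>)" for i
  have st: "fst (L' ! u) = fst (R ! u)" "x (Suc u) = x u + exp_a (L' ! u) - exp_a (R ! u)"
      "y (Suc u) = y u + exp_b (L' ! u) - exp_b (R ! u)"
      "if fst (R ! u) then int m * T dvd x u else int n * T dvd y u" if "u < k" for u
    using step[of u] that by (auto simp: R Let_def k_def)
  have "(\<Sum>i<k. c i) = weight L' + weight R"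
    unfolding c_def sum.distrib[of "\<lambda>i. \<bar>exp_a (L' ! i)\<bar> + \<bar>exp_b (L' ! i)\<bar>"] weight_def sum_list_sum_nth
    by (simp add: lR len k_def[symmetric] atLeast0LessThan)
  then have sum_c: "(\<Sum>i<k. c i) < T" using bnd by (simp add: R_def weight_rotate)
  have xb: "\<bar>x w - x u\<bar> < T" and yb: "\<bar>y w - y u\<bar> < T" if "u \<le> k" "w \<le> k" for u w
  proof -
    have "\<bar>x (max u w) - x (min u w)\<bar> \<le> (\<Sum>i<k. c i)"
      by (rule partial_sum_bound) (use that st(2) in \<open>auto simp: c_def\<close>)
    then show "\<bar>x w - x u\<bar> < T" using sum_c by (auto simp: max_def min_def split: if_splits)
    have "\<bar>y (max u w) - y (min u w)\<bar> \<le> (\<Sum>i<k. c i)"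
      by (rule partial_sum_bound) (use that st(3) in \<open>auto simp: c_def\<close>)
    then show "\<bar>y w - y u\<bar> < T" using sum_c by (auto simp: max_def min_def split: if_splits)
  qed
  \<comment> \<open>Without \<open>b\<close>-items the default is 0; \<open>sy\<close> is obtained
    in the same way from the \<open>a\<close>-items.\<close>
  obtain sx where sx: "int m dvd sx" "\<And>u. u < k \<Longrightarrow> fst (R ! u) \<Longrightarrow> x u = sx"
  proof (cases "\<exists>u<k. fst (R ! u)")
    case True
    then obtain u0 where u0: "u0 < k" "fst (R ! u0)" by blast
    have eq: "x u = x u0" if "u < k" "fst (R ! u)" for u
    proof -
      have "int m * T dvd x u - x u0"
        by (rule dvd_diff) (use st(4)[OF that(1)] st(4)[OF u0(1)] that(2) u0(2) in auto)
      moreover have "\<bar>x u - x u0\<bar> < T" using xb that(1) u0(1) less_imp_le by blast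
      ultimately have "x u - x u0 = 0" by (rule small_multiple_zero) (simp add: m_pos)
      then show ?thesis by simp
    qed
    have "int m dvd x u0" using div[of u0] u0(1) by (simp add: k_def)
    then show ?thesis by (rule that[OF _ eq])
  next
    case False
    then show ?thesis using that[of 0] by auto
  qed
  obtain sy where sy: "int n dvd sy" "\<And>u. u < k \<Longrightarrow> \<not> fst (R ! u) \<Longrightarrow> y u = sy"
  proof (cases "\<exists>u<k. \<not> fst (R ! u)")
    case True
    then obtain u0 where u0: "u0 < k" "\<not> fst (R ! u0)" by blast
    have eq: "y u = y u0" if "u < k" "\<not> fst (R ! u)" for u
    proof -
      have "int n * T dvd y u - y u0"
        by (rule dvd_diff) (use st(4)[OF that(1)] st(4)[OF u0(1)] that(2) u0(2) in auto)
      moreover have "\<bar>y u - y u0\<bar> < T" using yb that(1) u0(1) less_imp_le by blast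
      ultimately have "y u - y u0 = 0" by (rule small_multiple_zero) (simp add: n_pos)
      then show ?thesis by simp
    qed
    have "int n dvd y u0" using div[of u0] u0(1) by (simp add: k_def)
    then show ?thesis by (rule that[OF _ eq])
  next
    case False
    then show ?thesis using that[of 0] by auto
  qed
  let ?h = "pw False (x 0 - sx) @ pw True (y 0 - sy)"
  have "cl (pw False (x 0 - sx) @ pw True (y 0 - sy) @ list_word L') =
     cl (list_word R @ pw False (x (length R) - sx) @ pw True (y (length R) - sy))"
  proof (rule telescope[of L' R "\<lambda>u. x u - sx" "\<lambda>u. y u - sy"])
    show "\<forall>u<length R. fst (L' ! u) = fst (R ! u)
        \<and> x (Suc u) - sx = x u - sx + exp_a (L' ! u) - exp_a (R ! u)
        \<and> y (Suc u) - sy = y u - sy + exp_b (L' ! u) - exp_b (R ! u)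
        \<and> (if fst (R ! u) then x u - sx = 0 else y u - sy = 0)"
      using st sx(2) sy(2) by (auto simp: lR)
    show "\<forall>u\<le>length R. int m dvd x u - sx \<and> int n dvd y u - sy"
      using div sx(1) sy(1) by (auto simp: lR k_def)
  qed (use len good in \<open>auto simp: R_def\<close>)
  then have "cl (list_word R) \<otimes>\<^bsub>G\<^esub> cl ?h = cl ?h \<otimes>\<^bsub>G\<^esub> cl (list_word L')"
    using cyc by (simp add: lR k_def cl_append m_assoc)
  then have "conj_words r (list_word R) (list_word L')" unfolding conj_words_iff by blast
  then show ?thesis using conj_words_rotate_list conj_words_trans unfolding R_def by blast
qed

lemma not_dvd_small:
  assumes "z \<noteq> 0" "\<bar>z\<bar> < T" "d > 0"
  shows "\<not> int d * T dvd z"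
  using small_multiple_zero[of "int d" T z] assms by auto

text \<open>The periods are \<open>m * T\<close> and \<open>n * T\<close>: nonzero exponents of
  \<open>L\<close> are too small to be divisible by them, both powers in the relator act as
  translations, and a match would force conjugacy.\<close>

lemma separable_words_mixed:
  assumes red: "reduced L" and mixed: "\<And>t. \<exists>x\<in>set L. fst x = t"
    and val: "\<And>x. x \<in> set L' \<Longrightarrow> (if fst x then int m dvd exp_a x else int n dvd exp_b x)"
    and tot: "ea (list_word L') = ea (list_word L)" "eb (list_word L') = eb (list_word L)"
    and alt: "(\<forall>x\<in>set L'. fst x = t) \<or>
       length L' \<le> length L \<and> (\<forall>x\<in>set L'. good x) \<and> \<not> conj_words r (list_word L) (list_word L')"
  shows "separable_words r (list_word L) (list_word L')"
proof -
  define T where "T = weight L + weight L' + 1"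
  have T: "T > 0" "weight L < T" using weight_nonneg[of L] weight_nonneg[of L'] by (auto simp: T_def)
  have goodL: "\<forall>x\<in>set L. good x" using red by (simp add: reduced_def)
  have "separable_words r (list_word L) (list_word L') \<or> \<not> (\<forall>x\<in>set L'. fst x = t) \<and>
      (\<exists>v x y. list_match (int m) (int n) (int m * T) (int n * T) L L' v x y)"
  proof (rule separable_words_lists[where t = t])
    fix u assume u: "u < length L" "fst (L ! u) = fst (L ! (Suc u mod length L))"
    have "\<bar>exp_a (L ! u)\<bar> < T" "\<bar>exp_b (L ! u)\<bar> < T"
      using weight_mem[of "L ! u" L] u T by auto
    moreover have "if fst (L ! u) then exp_a (L ! u) \<noteq> 0 else exp_b (L ! u) \<noteq> 0"
      using red u unfolding reduced_def by blast
    ultimately show "if fst (L ! u) then \<not> int m * T dvd exp_a (L ! u) else \<not> int n * T dvd exp_b (L ! u)"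
      using not_dvd_small m_pos n_pos by (auto split: if_splits)
  qed (use T m_pos n_pos goodL mixed val tot alt in \<open>auto simp: good_def\<close>)
  then show ?thesis
  proof
    assume "\<not> (\<forall>x\<in>set L'. fst x = t) \<and>
      (\<exists>v x y. list_match (int m) (int n) (int m * T) (int n * T) L L' v x y)"
    then obtain v x y where nt: "\<not> (\<forall>x\<in>set L'. fst x = t)"
      and lm: "list_match (int m) (int n) (int m * T) (int n * T) L L' v x y" by blast
    have "conj_words r (list_word L) (list_word L')"
      by (rule match_imp_conj_words[of _ _ x y v T])
        (use lm nt alt goodL in \<open>auto simp: list_match_def Let_def T_def\<close>)
    then show ?thesis using nt alt by blast
  qed
qed

lemma list_word_double: "\<forall>x\<in>set L. fst x = t \<Longrightarrow> list_word (double t L) = list_word L"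
  by (induction L) (auto simp: part_def)

text \<open>The machine is driven by the doubled list. For type \<open>b\<close> the roles of the
  generators are exchanged, hence the factors depending on \<open>t\<close>: one modulus equals its
  period, the other is enlarged by \<open>T\<close> so that nonzero separating exponents count as
  syllables.\<close>

lemma separable_words_pure:
  assumes red: "reduced L" and pure: "\<forall>x\<in>set L. fst x = t"
    and T: "weight L < T"
    and val: "\<And>x. x \<in> set L' \<Longrightarrow> (if fst x then exp_a x = 0 \<or> \<not> t \<and> int m dvd exp_a x
                                      else exp_b x = 0 \<or> t \<and> int n dvd exp_b x)"
    and tot: "ea (list_word L') = ea (list_word L)" "eb (list_word L') = eb (list_word L)"
    and len: "length L' \<le> 2 * length L \<or> (\<forall>x\<in>set L'. fst x = s)"
  shows "separable_words r (list_word L) (list_word L') \<or>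
     (\<exists>v x y. list_match (int m * (if t then T else 1)) (int n * (if t then 1 else T))
       (int m * (if t then T else 1)) (int n * (if t then 1 else T)) (double t L) L' v x y)"
proof -
  let ?m = "int m * (if t then T else 1)" and ?n = "int n * (if t then 1 else T)"
  have T0: "T > 0" using weight_nonneg[of L] T by linarith
  have L: "L \<noteq> []" "\<forall>x\<in>set L. good x" using red by (auto simp: reduced_def)
  \<comment> \<open>All cyclic neighbours have the same type, so every separating exponent is
    nonzero.\<close>
  have nz: "if t then exp_a x \<noteq> 0 else exp_b x \<noteq> 0" if x: "x \<in> set L" for x
  proof -
    obtain u where u: "u < length L" "L ! u = x" using x by (auto simp: in_set_conv_nth)
    then have "Suc u mod length L < length L" by (intro mod_less_divisor) auto
    then have "fst (L ! u) = t" "fst (L ! (Suc u mod length L)) = t" using pure u nth_mem by blast+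
    then show ?thesis using red u unfolding reduced_def by metis
  qed
  have part: "if t then \<not> int m * T dvd exp_a x \<and> \<not> int n dvd exp_b x
      else \<not> int n * T dvd exp_b x \<and> \<not> int m dvd exp_a x" if "x \<in> set L" for x
    using nz[OF that] weight_mem[OF that] T pure L(2) that not_dvd_small[of "exp_a x" T m]
      not_dvd_small[of "exp_b x" T n] m_pos n_pos by (auto simp: good_def split: if_splits)
  have "separable_words r (list_word (double t L)) (list_word L') \<or>
    \<not> (\<forall>x\<in>set L'. fst x = s) \<and> (\<exists>v x y. list_match ?m ?n ?m ?n (double t L) L' v x y)"
  proof (rule separable_words_lists[where t = s])
    show "\<not> ?m dvd exp_a x \<and> ?n dvd exp_b x" if xm: "x \<in> set (double t L)" "\<not> fst x" for x
    proof -
      obtain z s where "z \<in> set L" "x = part s z" by (rule double_cases[OF xm(1)])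
      then show ?thesis using part[of z] xm(2) by (auto split: if_splits)
    qed
    show "\<not> ?n dvd exp_b x \<and> ?m dvd exp_a x" if xm: "x \<in> set (double t L)" "fst x" for x
    proof -
      obtain z s where "z \<in> set L" "x = part s z" by (rule double_cases[OF xm(1)])
      then show ?thesis using part[of z] xm(2) by (auto split: if_splits)
    qed
    show "\<exists>x\<in>set (double t L). fst x = t'" for t'
      using L(1) by (cases L; cases "t' = t") (auto simp: part_def)
    fix u assume u: "u < length (double t L)"
      "fst (double t L ! u) = fst (double t L ! (Suc u mod length (double t L)))"
    \<comment> \<open>The doubled list has even length and alternating types, so cyclic neighbours
      never agree and the adjacency condition is vacuous.\<close>
    have "Suc u mod length (double t L) < 2 * length L" using L(1) by (simp add: mod_less_divisor)
    then have "even u = even (Suc u mod (2 * length L))"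
      using u nth_double_type[of _ L t] by (auto split: if_splits)
    moreover have "even (Suc u mod (2 * length L)) = even (Suc u)" by (simp add: dvd_mod_iff)
    ultimately have False by simp
    then show "if fst (double t L ! u) then \<not> ?m dvd exp_a (double t L ! u) else \<not> ?n dvd exp_b (double t L ! u)" ..
  next
    show "length L' \<le> length (double t L) \<or> (\<forall>x\<in>set L'. fst x = s)" using len by simp
    show "if fst x then ?m dvd exp_a x else ?n dvd exp_b x" if "x \<in> set L'" for x
      using val[OF that] by (cases t) auto
  qed (use T0 m_pos n_pos tot pure in \<open>auto simp: list_word_double\<close>)
  then show ?thesis using pure by (auto simp: list_word_double)
qed

text \<open>Two consecutive steps of the doubled match make one step between the original items;
  here modulus and period coincide, so the strong divisibility holds at every position.\<close>

lemma double_match_imp_conj_words: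
  fixes t :: bool and T :: int
  defines "m' \<equiv> int m * (if t then T else 1)" and "n' \<equiv> int n * (if t then 1 else T)"
  assumes red: "reduced L" "reduced L'" and pure: "\<forall>x\<in>set L. fst x = t" "\<forall>x\<in>set L'. fst x = t"
    and bnd: "weight L + weight L' < T"
    and lm: "list_match m' n' m' n' (double t L) (double t L') v x y"
  shows "conj_words r (list_word L) (list_word L')"
proof -
  define k where "k = length L"
  have L: "L \<noteq> []" "\<forall>x\<in>set L. good x" "\<forall>x\<in>set L'. good x" using red by (auto simp: reduced_def)
  have k: "k > 0" using L by (simp add: k_def)
  have len: "length L' = k" using lm by (simp add: list_match_def k_def)
  have at: "let z = double t L ! ((v + i) mod (2 * k)) in
          fst (double t L' ! i) = fst z
        \<and> x (Suc i) = x i + exp_a (double t L' ! i) - exp_a z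
        \<and> y (Suc i) = y i + exp_b (double t L' ! i) - exp_b z" if "i < 2 * k" for i
    using lm that by (auto simp: list_match_def Let_def k_def)
  have dv: "m' dvd x i \<and> n' dvd y i" if "i \<le> 2 * k" for i
    using lm that by (auto simp: list_match_def k_def)
  \<comment> \<open>Both doubled lists start with type \<open>t\<close> and alternate, so the offset
    of the match is even.\<close>
  have "fst (double t L ! (v mod (2 * k))) = fst (double t L' ! 0)" using at[of 0] k by (simp add: Let_def)
  also have "\<dots> = t" using nth_double_type[of 0 L' t] k len by simp
  finally have "even (v mod (2 * k))" using nth_double_type[of "v mod (2 * k)" L t] k
    by (auto simp: k_def split: if_splits)
  then obtain w where w: "v mod (2 * k) = 2 * w" by (elim evenE)
  have i0: "(v + 2 * u) mod (2 * k) = 2 * ((w + u) mod k)" for u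
  proof -
    have "(v + 2 * u) mod (2 * k) = (v mod (2 * k) + 2 * u) mod (2 * k)" by (simp only: mod_add_left_eq)
    also have "\<dots> = (2 * (w + u)) mod (2 * k)" by (simp add: w)
    finally show ?thesis by (simp only: mult_mod_right)
  qed
  have i1: "(v + Suc (2 * u)) mod (2 * k) = Suc (2 * ((w + u) mod k))" for u
  proof -
    have "(v + Suc (2 * u)) mod (2 * k) = (v mod (2 * k) + Suc (2 * u)) mod (2 * k)" by (simp only: mod_add_left_eq)
    also have "\<dots> = Suc (2 * (w + u)) mod (2 * k)" by (simp add: w)
    finally show ?thesis by (simp only: Suc_double_mod)
  qed
  have nd: "double t L ! (2 * ((w + u) mod k)) = part t (L ! ((w + u) mod k))"
     "double t L ! Suc (2 * ((w + u) mod k)) = part (\<not> t) (L ! ((w + u) mod k))" for u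
    using nth_double[of "(w + u) mod k" L t] k by (auto simp: k_def)
  have nd': "double t L' ! (2 * u) = part t (L' ! u)" "double t L' ! Suc (2 * u) = part (\<not> t) (L' ! u)"
    if "u < k" for u
    using nth_double[of u L' t] that len by auto
  show ?thesis
  proof (rule match_imp_conj_words[of L' L "\<lambda>u. x (2 * u)" "\<lambda>u. y (2 * u)" w T])
    show "x (2 * length L) = x (2 * 0)" "y (2 * length L) = y (2 * 0)"
      using lm by (auto simp: list_match_def)
    show "int m dvd x (2 * u) \<and> int n dvd y (2 * u)" if "u \<le> length L" for u
      using dv[of "2 * u"] that by (auto simp: k_def m'_def n'_def intro: dvd_mult_left)
    fix u assume "u < length L"
    then have u: "u < k" by (simp add: k_def)
    let ?z = "L ! ((w + u) mod k)"
    have "?z \<in> set L" using k by (simp add: k_def)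
    then have tz: "fst ?z = t" "fst (L' ! u) = t" using pure u len by auto
    have a0: "x (Suc (2 * u)) = x (2 * u) + exp_a (part t (L' ! u)) - exp_a (part t ?z)"
        "y (Suc (2 * u)) = y (2 * u) + exp_b (part t (L' ! u)) - exp_b (part t ?z)"
      using at[of "2 * u"] u unfolding i0 nd nd'[OF u] by (auto simp: Let_def)
    have a1: "x (Suc (Suc (2 * u))) = x (Suc (2 * u)) + exp_a (part (\<not> t) (L' ! u)) - exp_a (part (\<not> t) ?z)"
        "y (Suc (Suc (2 * u))) = y (Suc (2 * u)) + exp_b (part (\<not> t) (L' ! u)) - exp_b (part (\<not> t) ?z)"
      using at[of "Suc (2 * u)"] u unfolding i1 nd nd'[OF u] by (auto simp: Let_def)
    have "if t then int m * T dvd x (2 * u) else int n * T dvd y (2 * u)"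
      using dv[of "2 * u"] u by (auto simp: m'_def n'_def)
    then show "let z = L ! ((w + u) mod length L) in fst (L' ! u) = fst z
        \<and> x (2 * Suc u) = x (2 * u) + exp_a (L' ! u) - exp_a z
        \<and> y (2 * Suc u) = y (2 * u) + exp_b (L' ! u) - exp_b z
        \<and> (if fst z then int m * T dvd x (2 * u) else int n * T dvd y (2 * u))"
      using a0 a1 tz by (cases t) (simp_all add: Let_def k_def[symmetric])
  qed (use len L bnd in \<open>auto simp: k_def\<close>)
qed

text \<open>An element of \<open><a^m, b^n>\<close> can be written as an item of either type;
  \<open>\<not> t\<close> is the type valid for the machine of a list of type
  \<open>t\<close>.\<close>

lemma elliptic_item:
  assumes "elliptic w"
  obtains x where "cl (list_word [x]) = cl w"
    "if fst x then exp_a x = 0 \<or> \<not> t \<and> int m dvd exp_a x else exp_b x = 0 \<or> t \<and> int n dvd exp_b x"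
proof -
  obtain p q where w: "w = pw False p @ pw True q" and c: "p = 0 \<or> q = 0 \<or> int m dvd p \<and> int n dvd q"
    using assms by (auto simp: elliptic_def)
  from c consider "p = 0" | "q = 0" | "int m dvd p" "int n dvd q" by blast
  then show ?thesis
  proof cases
    case 1
    then show ?thesis by (intro that[of "(True, p, q)"]) (auto simp: w)
  next
    case 2
    then show ?thesis by (intro that[of "(False, p, q)"]) (auto simp: w)
  next
    case 3
    then show ?thesis using commute_pw[OF 3]
      by (intro that[of "(\<not> t, p, q)"]) (auto simp: w cl_append)
  qed
qed

definition mixed :: "item list \<Rightarrow> bool" where
  "mixed L \<longleftrightarrow> (\<forall>t. \<exists>x\<in>set L. fst x = t)"

lemma separable_words_cong_right: "separable_words r f g \<Longrightarrow> cl g = cl g' \<Longrightarrow> separable_words r f g'"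
  using separable_words_sym separable_words_conj conj_words_eq by metis

lemma ea_word_eqv: "word_eqv r u v \<Longrightarrow> ea u = ea v \<and> eb u = eb v"
  by (induction rule: word_eqv.induct) (auto simp: comm_relator_pw)

lemma not_mixed_one_type: "\<not> mixed L \<Longrightarrow> \<exists>t. \<forall>x\<in>set L. fst x = t"
  by (auto simp: mixed_def)

lemma separable_words_reduced_elliptic:
  assumes red: "reduced L" and ell: "elliptic w"
    and tot: "ea w = ea (list_word L)" "eb w = eb (list_word L)"
  shows "separable_words r (list_word L) w"
proof (cases "mixed L")
  case True
  obtain x where x: "cl (list_word [x]) = cl w"
    "if fst x then exp_a x = 0 \<or> \<not> True \<and> int m dvd exp_a x else exp_b x = 0 \<or> True \<and> int n dvd exp_b x"
    using elliptic_item[OF ell] by blast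
  have "ea (list_word [x]) = ea w" "eb (list_word [x]) = eb w"
    using x(1) ea_word_eqv by (auto simp: cl_eq_iff)
  then have "separable_words r (list_word L) (list_word [x])"
    using True x(2) tot by (intro separable_words_mixed[OF red, of _ "fst x"]) (auto simp: mixed_def split: if_splits)
  then show ?thesis using x(1) separable_words_cong_right by blast
next
  case False
  then obtain t where t: "\<forall>x\<in>set L. fst x = t" using not_mixed_one_type by blast
  obtain x where x: "cl (list_word [x]) = cl w"
    "if fst x then exp_a x = 0 \<or> \<not> t \<and> int m dvd exp_a x else exp_b x = 0 \<or> t \<and> int n dvd exp_b x"
    using elliptic_item[OF ell] by blast
  have e: "ea (list_word [x]) = ea w" "eb (list_word [x]) = eb w"
    using x(1) ea_word_eqv by (auto simp: cl_eq_iff)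
  have L: "L \<noteq> []" using red by (simp add: reduced_def)
  \<comment> \<open>A match requires equal lengths, and a doubled list has even length.\<close>
  have "\<not> list_match M N M' N' (double t L) [x] v a b" for M N M' N' v a b
    by (auto simp: list_match_def)
  then have "separable_words r (list_word L) (list_word [x])"
    using separable_words_pure[OF red t, of "weight L + 1" "[x]" "fst x"] x(2) tot e by auto
  then show ?thesis using x(1) separable_words_cong_right by blast
qed

text \<open>The machine comes from the list of higher rank, mixed before pure and then longer before
  shorter, because it detects only lists that are long enough and of suitable types.\<close>

lemma separable_words_reduced:
  assumes red: "reduced L" "reduced L'"
    and tot: "ea (list_word L') = ea (list_word L)" "eb (list_word L') = eb (list_word L)"
    and nc: "\<not> conj_words r (list_word L) (list_word L')"
    and rank: "mixed L \<and> \<not> mixed L' \<or> mixed L = mixed L' \<and> length L' \<le> length L"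
  shows "separable_words r (list_word L) (list_word L')"
proof (cases "mixed L")
  case True
  have good: "\<forall>x\<in>set L'. good x" using red by (simp add: reduced_def)
  have "\<exists>t. (\<forall>x\<in>set L'. fst x = t) \<or>
       length L' \<le> length L \<and> (\<forall>x\<in>set L'. good x) \<and> \<not> conj_words r (list_word L) (list_word L')"
    using rank nc good not_mixed_one_type by blast
  then show ?thesis
    using True good tot by (elim exE) (rule separable_words_mixed[OF red(1)], auto simp: mixed_def good_def)
next
  case False
  then have len: "length L' \<le> length L" and nm: "\<not> mixed L'" using rank by auto
  have ne: "L \<noteq> []" "L' \<noteq> []" and good: "\<forall>x\<in>set L'. good x" using red by (auto simp: reduced_def)
  obtain t where t: "\<forall>x\<in>set L. fst x = t" using False not_mixed_one_type by blast
  obtain s where s: "\<forall>x\<in>set L'. fst x = s" using nm not_mixed_one_type by blast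
  define T where "T = weight L + weight L' + 1"
  have T: "weight L < T" using weight_nonneg[of L'] by (simp add: T_def)
  show ?thesis
  proof (cases "s = t")
    case True
    have "separable_words r (list_word L) (list_word (double t L')) \<or>
      (\<exists>v x y. list_match (int m * (if t then T else 1)) (int n * (if t then 1 else T))
       (int m * (if t then T else 1)) (int n * (if t then 1 else T)) (double t L) (double t L') v x y)"
    proof (rule separable_words_pure[OF red(1) t T])
      fix x assume "x \<in> set (double t L')"
      then obtain z s where "x = part s z" by (rule double_cases)
      then show "if fst x then exp_a x = 0 \<or> \<not> t \<and> int m dvd exp_a x else exp_b x = 0 \<or> t \<and> int n dvd exp_b x"
        by simp
    qed (use tot len s True in \<open>auto simp: list_word_double\<close>)
    then show ?thesis
    proof
      assume "separable_words r (list_word L) (list_word (double t L'))"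
      then show ?thesis using s True by (simp add: list_word_double)
    next
      assume "\<exists>v x y. list_match (int m * (if t then T else 1)) (int n * (if t then 1 else T))
       (int m * (if t then T else 1)) (int n * (if t then 1 else T)) (double t L) (double t L') v x y"
      then obtain v x y where "list_match (int m * (if t then T else 1)) (int n * (if t then 1 else T))
       (int m * (if t then T else 1)) (int n * (if t then 1 else T)) (double t L) (double t L') v x y"
        by blast
      then have "conj_words r (list_word L) (list_word L')"
        by (rule double_match_imp_conj_words[OF red t, rotated 2]) (use s True in \<open>auto simp: T_def\<close>)
      then show ?thesis using nc by blast
    qed
  next
    case False
    have "separable_words r (list_word L) (list_word L') \<or>
      (\<exists>v x y. list_match (int m * (if t then T else 1)) (int n * (if t then 1 else T))
       (int m * (if t then T else 1)) (int n * (if t then 1 else T)) (double t L) L' v x y)"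
    proof (rule separable_words_pure[OF red(1) t T])
      show "length L' \<le> 2 * length L \<or> (\<forall>x\<in>set L'. fst x = s)" using len by simp
      show "if fst x then exp_a x = 0 \<or> \<not> t \<and> int m dvd exp_a x else exp_b x = 0 \<or> t \<and> int n dvd exp_b x"
        if "x \<in> set L'" for x
        using good s False that by (cases t) (auto simp: good_def)
    qed (use tot in auto)
    \<comment> \<open>Of the other type, \<open>L'\<close> is valid undoubled, and it is then too
      short for a match.\<close>
    moreover have "length L' \<noteq> 2 * length L" using len ne by auto
    ultimately show ?thesis by (auto simp: list_match_def)
  qed
qed

lemma conj_words_ea: "conj_words r u v \<Longrightarrow> ea u = ea v \<and> eb u = eb v"
  using ea_word_eqv by (fastforce simp: conj_words_def)

text \<open>Different exponent sums are separated in a cyclic quotient; otherwise both words are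
  replaced by their conjugate normal forms, and a machine of a reduced one decides.\<close>

theorem separable_words_if_not_conj_words:
  assumes nc: "\<not> conj_words r f g"
  shows "separable_words r f g"
proof (cases "ea f = ea g \<and> eb f = eb g")
  case False
  then show ?thesis
    using separable_words_additive[of ea r f g] separable_words_additive[of eb r f g] by (auto simp: comm_relator_pw)
next
  case True
  obtain f' where f': "conj_words r f f'" "elliptic f' \<or> (\<exists>L. reduced L \<and> f' = list_word L)"
    using word_reduces[of f] by (elim exE conjE) (rule that)
  obtain g' where g': "conj_words r g g'" "elliptic g' \<or> (\<exists>L. reduced L \<and> g' = list_word L)"
    using word_reduces[of g] by (elim exE conjE) (rule that)
  have tot: "ea f' = ea g'" "eb f' = eb g'"
    using True conj_words_ea[OF f'(1)] conj_words_ea[OF g'(1)] by auto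
  have nc': "\<not> conj_words r f' g'" "\<not> conj_words r g' f'"
    using nc f'(1) g'(1) conj_words_trans conj_words_sym by blast+
  have "separable_words r f' g'"
  proof (cases "elliptic f'")
    case ef: True
    show ?thesis
    proof (cases "elliptic g'")
      case True
      \<comment> \<open>The exponents of an elliptic word are its exponent sums.\<close>
      then have "f' = g'" using ef tot by (auto simp: elliptic_def)
      then show ?thesis using nc' conj_words_eq by blast
    next
      case False
      then obtain L where "reduced L" "g' = list_word L" using g' by blast
      then show ?thesis using separable_words_reduced_elliptic[of L f'] ef tot separable_words_sym by simp
    qed
  next
    case False
    then obtain L where L: "reduced L" "f' = list_word L" using f' by blast
    show ?thesis
    proof (cases "elliptic g'")
      case True
      then show ?thesis using separable_words_reduced_elliptic[of L g'] L tot by simp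
    next
      case False
      then obtain L' where L': "reduced L'" "g' = list_word L'" using g' by blast
      \<comment> \<open>Ranks are comparable and separation is symmetric, so the higher-ranked list
        may drive the machine.\<close>
      have "mixed L \<and> \<not> mixed L' \<or> mixed L = mixed L' \<and> length L' \<le> length L \<or>
        mixed L' \<and> \<not> mixed L \<or> mixed L' = mixed L \<and> length L \<le> length L'" by linarith
      then show ?thesis
        using separable_words_reduced[OF L(1) L'(1)] separable_words_reduced[OF L'(1) L(1)] separable_words_sym nc' tot L(2) L'(2) by metis
    qed
  qed
  then have "separable_words r f g'" using f'(1) by (rule separable_words_conj)
  then have "separable_words r g' f" by (rule separable_words_sym)
  then have "separable_words r g f" using g'(1) by (rule separable_words_conj)
  then show ?thesis by (rule separable_words_sym)
qed

end

section \<open>Conjugacy separability of the one-relator group\<close>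

theorem mainTheorem1:
  fixes m n :: nat
  assumes "m > 1" and "n > 1"
  shows "group (G_mn m n) \<and> conjugacy_separable (G_mn m n)"
proof
  interpret pres_mn m n using assms by unfold_locales auto
  let ?E = "word_eqv (comm_relator m n)"
  have eq: "G_mn m n = quotient_group ?E" by (simp add: G_mn_def pres_group_eq)
  show "group (G_mn m n)"
    unfolding eq by (rule group_quotient_group[OF word_cong_word_eqv])
  show "conjugacy_separable (G_mn m n)"
    unfolding conjugacy_separable_def
  proof (intro ballI impI)
    fix f g
    assume "f \<in> carrier (G_mn m n)" "g \<in> carrier (G_mn m n)" and nc: "\<not> conjugate_in (G_mn m n) f g"
    then obtain u v where uv: "f = word_class ?E u" "g = word_class ?E v"
      unfolding eq carrier_quotient_group[OF word_cong_word_eqv] by blast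
    have "\<not> conj_words (comm_relator m n) u v"
      using nc unfolding uv eq conjugate_in_quotient_group[OF word_cong_word_eqv] conj_words_def .
    then have "separable_words (comm_relator m n) u v" by (rule separable_words_if_not_conj_words)
    from separable_words_imp_finite_quotient[OF this]
    show "\<exists>(X :: nat monoid) \<phi>. group X \<and> finite (carrier X) \<and> \<phi> \<in> hom (G_mn m n) X \<and>
           \<phi> ` carrier (G_mn m n) = carrier X \<and> \<not> conjugate_in X (\<phi> f) (\<phi> g)"
      unfolding uv G_mn_def .
  qed
qed

end
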